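(* Let $d,n,g,r,k,l\in\mathbb N$ and let $\Psi:\mathcal M(\mathbb C)_{kdg}\to\mathcal M(\mathbb C)_{lnr}$ be a completely positive (CP) map such that $\Psi(\mathcal J(\mathcal{MM}(g,k,d)))\subseteq\mathcal J(\mathcal{MM}(r,l,n))$. Then there exist $s\in\mathbb N$ (an ancillary system $\mathbb C^s$), CP maps $\Lambda^*_{x|y}:\mathcal M(\mathbb C)_{ds}\to\mathcal M(\mathbb C)_n$ ($x\in[g]$, $y\in[r]$) such that $\Lambda^*_y:=\sum_{x\in[g]}\Lambda^*_{x|y}$ is a unital CP map for all $y\in[r]$, and a set of POVMs $B=\{B_{\cdot|a,x,y}\}_{a\in[k],x\in[g],y\in[r]}\subset\mathfrak M(l,\mathbb C^s)$ such that for all $M=\{M_{\cdot|x}\}_{x\in[g]}\subset\mathfrak M(k,\mathbb C^d)$ one has $$\Psi\left(J_{\Phi_M}\right)=J_{\Phi_N},\qquad N=\{N_{\cdot|y}\}_{y\in[r]},\qquad N_{b|y}:=\sum_{x=1}^g\sum_{a=1}^k\Lambda^*_{x|y}\left(M_{a|x}\otimes B_{b|a,x,y}\right)\quad (b\in[l],\,y\in[r]),$$ where $N=\{N_{\cdot|y}\}_{y\in[r]}\subset\mathfrak M(l,\mathbb C^n)$ is a set of POVMs.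
   Context: Notation: $[m]=\{1,\dots,m\}$; $\mathcal M(\mathbb C)_m$ is the set of complex $m\times m$ matrices, and $\mathcal M(\mathbb C)_{ds}$ is identified with $\mathcal M(\mathbb C)_d\otimes\mathcal M(\mathbb C)_s$, $\mathcal M(\mathbb C)_{kdg}$ with $\mathcal M(\mathbb C)_k\otimes\mathcal M(\mathbb C)_d\otimes\mathcal M(\mathbb C)_g$, etc. $\mathfrak M(k,\mathbb C^d)$ is the set of $k$-outcome POVMs on $\mathbb C^d$, i.e. tuples $(M_a)_{a\in[k]}$ of positive semidefinite $d\times d$ matrices with $\sum_a M_a=\mathbb 1_d$. A multimeter is a collection $M=\{M_{\cdot|x}\}_{x\in[g]}\subset\mathfrak M(k,\mathbb C^d)$ of $g$ POVMs with $k$ outcomes on $\mathbb C^d$. Its multimeter channel is $\Phi_M:\mathcal M(\mathbb C)_{dg}\to\mathcal M(\mathbb C)_k$, $\Phi_M(\sigma)=\sum_{x=1}^g\sum_{a=1}^k\mathrm{Tr}[(M_{a|x}\otimes|x\rangle\langle x|)\sigma]\,|a\rangle\langle a|$, for fixed orthonormal bases of $\mathbb C^g$ and $\mathbb C^k$. $\mathcal{MM}(g,k,d)$ denotes the set of all such channels. The Choi matrix of a linear map $\Phi:\mathcal M(\mathbb C)_m\to\mathcal M(\mathbb C)_{m'}$ is $J_\Phi=\sum_{i,j=1}^m\Phi(|i\rangle\langle j|)\otimes|i\rangle\langle j|$ (fixed orthonormal basis); thus $J_{\Phi_M}=\sum_{x=1}^g\sum_{a=1}^k|a\rangle\langle a|\otimes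 M_{a|x}^T\otimes|x\rangle\langle x|\in\mathcal M(\mathbb C)_{kdg}$. $\mathcal J(\mathcal{MM}(g,k,d))=\{J_{\Phi_M}:M=\{M_{\cdot|x}\}_{x\in[g]}\subset\mathfrak M(k,\mathbb C^d)\}$. *)

theory Defs
  imports "Jordan_Normal_Form.Matrix"
begin

text \<open>Matrices are the carrier-based ones of \<^theory>\<open>Jordan_Normal_Form.Matrix\<close>, since the
  ancilla dimension \<open>s\<close> is existentially quantified.  All indices are 0-based: \<open>[m]\<close> is rendered
  as \<open>{..<m}\<close>, and \<open>M\<^bsub>a|x\<^esub>\<close> as \<open>M x a\<close>.  Linear maps between matrix algebras are HOL
  functions of which only the values on the respective carrier matter.\<close>

text \<open>The type of matrices of all sizes is no \<^class>\<open>comm_monoid_add\<close>, hence this explicit sum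
  of a finite family in \<open>carrier_mat n n\<close>.\<close>

definition msum :: "nat \<Rightarrow> ('i \<Rightarrow> complex mat) \<Rightarrow> 'i set \<Rightarrow> complex mat" where
  "msum n f I = mat n n (\<lambda>(i, j). \<Sum>t\<in>I. f t $$ (i, j))"

definition mtrace :: "complex mat \<Rightarrow> complex" where
  "mtrace A = (\<Sum>i<dim_row A. A $$ (i, i))"

text \<open>\<open>ketbra m i j\<close> is \<open>|i\<rangle>\<langle>j|\<close> in the standard basis of \<open>\<complex>\<^sup>m\<close>.\<close>

definition ketbra :: "nat \<Rightarrow> nat \<Rightarrow> nat \<Rightarrow> complex mat" where
  "ketbra m i j = mat m m (\<lambda>(u, v). if u = i \<and> v = j then 1 else 0)"

text \<open>The identification of \<open>M\<^sub>m \<otimes> M\<^sub>n\<close> with \<open>M\<^bsub>mn\<^esub>\<close> pairs the basis indices \<open>(i, u)\<close>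
  to \<open>i * n + u\<close>.\<close>

definition kron :: "complex mat \<Rightarrow> complex mat \<Rightarrow> complex mat" (infixr \<open>\<otimes>\<^sub>K\<close> 72) where
  "A \<otimes>\<^sub>K B = mat (dim_row A * dim_row B) (dim_col A * dim_col B)
     (\<lambda>(i, j). A $$ (i div dim_row B, j div dim_col B) * B $$ (i mod dim_row B, j mod dim_col B))"

text \<open>The inequality below is in the order on complex numbers, so it also says that the
  quadratic form is real-valued; over the complex numbers this makes \<open>A\<close> Hermitian.\<close>

definition psd :: "nat \<Rightarrow> complex mat \<Rightarrow> bool" where
  "psd n A \<longleftrightarrow> A \<in> carrier_mat n n \<and> (\<forall>v\<in>carrier_vec n. 0 \<le> (A *\<^sub>v v) \<bullet>c v)"

definition linear_map :: "nat \<Rightarrow> nat \<Rightarrow> (complex mat \<Rightarrow> complex mat) \<Rightarrow> bool" where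
  "linear_map m m' \<Phi> \<longleftrightarrow>
     (\<forall>A\<in>carrier_mat m m. \<Phi> A \<in> carrier_mat m' m') \<and>
     (\<forall>A\<in>carrier_mat m m. \<forall>B\<in>carrier_mat m m. \<Phi> (A + B) = \<Phi> A + \<Phi> B) \<and>
     (\<forall>c. \<forall>A\<in>carrier_mat m m. \<Phi> (c \<cdot>\<^sub>m A) = c \<cdot>\<^sub>m \<Phi> A)"

text \<open>\<open>ampliation p m m' \<Phi>\<close> is \<open>id\<^sub>p \<otimes> \<Phi>\<close>, which applies \<open>\<Phi>\<close> to each of the \<open>p \<times> p\<close> blocks of
  size \<open>m \<times> m\<close>.\<close>

definition ampliation ::
    "nat \<Rightarrow> nat \<Rightarrow> nat \<Rightarrow> (complex mat \<Rightarrow> complex mat) \<Rightarrow> complex mat \<Rightarrow> complex mat" where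
  "ampliation p m m' \<Phi> X =
     msum (p * m')
       (\<lambda>(i, j). ketbra p i j \<otimes>\<^sub>K \<Phi> (mat m m (\<lambda>(u, v). X $$ (i * m + u, j * m + v))))
       ({..<p} \<times> {..<p})"

definition completely_positive :: "nat \<Rightarrow> nat \<Rightarrow> (complex mat \<Rightarrow> complex mat) \<Rightarrow> bool" where
  "completely_positive m m' \<Phi> \<longleftrightarrow>
     linear_map m m' \<Phi> \<and> (\<forall>p X. psd (p * m) X \<longrightarrow> psd (p * m') (ampliation p m m' \<Phi> X))"

definition unital :: "nat \<Rightarrow> nat \<Rightarrow> (complex mat \<Rightarrow> complex mat) \<Rightarrow> bool" where
  "unital m m' \<Phi> \<longleftrightarrow> \<Phi> (1\<^sub>m m) = 1\<^sub>m m'"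

definition povm :: "nat \<Rightarrow> nat \<Rightarrow> (nat \<Rightarrow> complex mat) \<Rightarrow> bool" where
  "povm k d M \<longleftrightarrow> (\<forall>a<k. psd d (M a)) \<and> msum d M {..<k} = 1\<^sub>m d"

definition multimeter :: "nat \<Rightarrow> nat \<Rightarrow> nat \<Rightarrow> (nat \<Rightarrow> nat \<Rightarrow> complex mat) \<Rightarrow> bool" where
  "multimeter g k d M \<longleftrightarrow> (\<forall>x<g. povm k d (M x))"

definition multimeter_channel ::
    "nat \<Rightarrow> nat \<Rightarrow> (nat \<Rightarrow> nat \<Rightarrow> complex mat) \<Rightarrow> complex mat \<Rightarrow> complex mat" where
  "multimeter_channel g k M \<sigma> =
     msum k (\<lambda>(x, a). mtrace ((M x a \<otimes>\<^sub>K ketbra g x x) * \<sigma>) \<cdot>\<^sub>m ketbra k a a)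
       ({..<g} \<times> {..<k})"

definition MM :: "nat \<Rightarrow> nat \<Rightarrow> nat \<Rightarrow> (complex mat \<Rightarrow> complex mat) set" where
  "MM g k d = {multimeter_channel g k M |M. multimeter g k d M}"

definition choi :: "nat \<Rightarrow> nat \<Rightarrow> (complex mat \<Rightarrow> complex mat) \<Rightarrow> complex mat" where
  "choi m m' \<Phi> =
     msum (m' * m) (\<lambda>(i, j). \<Phi> (ketbra m i j) \<otimes>\<^sub>K ketbra m i j) ({..<m} \<times> {..<m})"

end

theory Submission
  imports Defs "HOL-Analysis.L2_Norm"
begin

text \<open>On multimeters, \<open>\<Psi>\<close> acts as \<open>N\<^bsub>b|y\<^esub> = (\<Sum>x a. F\<^bsub>xyab\<^esub> (M\<^bsub>a|x\<^esub>))\<close> with completely positive \<open>F\<^bsub>xyab\<^esub>\<close> cut out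
  of \<open>\<Psi>\<close>.  That the \<open>N\<^bsub>b|y\<^esub>\<close> sum up to \<open>1\<close> for every multimeter forces \<open>\<Sum>b. F\<^bsub>xyab\<^esub>\<close> to be independent
  of \<open>a\<close>: move an effect \<open>P\<close> from one outcome to another.  So for fixed \<open>x, y\<close> the families
  \<open>(F\<^bsub>xyab\<^esub>)\<^sub>b\<close> are decompositions, one for each \<open>a\<close>, of a single completely positive map.  The
  finite-dimensional Radon-Nikodym theorem turns them into POVMs \<open>B\<^bsub>.|a,x,y\<^esub>\<close> on the ancilla of one
  Stinespring dilation \<open>V\<^bsub>xy\<^esub>\<close> of that map, and \<open>\<Lambda>\<^bsub>x|y\<^esub> = V\<^bsub>xy\<^esub>\<^sup>* (.) V\<^bsub>xy\<^esub>\<close>.  On the level of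
  Choi matrices the dilation is a factorization \<open>R R\<^sup>*\<close> with square \<open>R\<close>, so \<open>s = d n\<close> suffices
  for all \<open>x\<close> and \<open>y\<close>.\<close>

subsection \<open>Positive semidefinite forms\<close>

text \<open>The value <w, F w>. Forms are plain functions on indices, of which only those below the
  dimension count, so that sums can be rearranged without carrier conditions;
  \<open>psd_iff_pos_form\<close> links them to matrices.\<close>

definition qform :: "nat \<Rightarrow> (nat \<Rightarrow> nat \<Rightarrow> complex) \<Rightarrow> (nat \<Rightarrow> complex) \<Rightarrow> complex" where
  "qform N F w = (\<Sum>i<N. \<Sum>j<N. F i j * w j * cnj (w i))"

definition pos_form :: "nat \<Rightarrow> (nat \<Rightarrow> nat \<Rightarrow> complex) \<Rightarrow> bool" where
  "pos_form N F \<longleftrightarrow> (\<forall>w. 0 \<le> qform N F w)"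

text \<open>An entry of A F A^*, for \<open>F\<close> of size \<open>M\<close>. The number of rows
  of \<open>A\<close> is left open, so rectangular factors are covered.\<close>

definition congr :: "nat \<Rightarrow> (nat \<Rightarrow> nat \<Rightarrow> complex) \<Rightarrow> (nat \<Rightarrow> nat \<Rightarrow> complex) \<Rightarrow> nat \<Rightarrow> nat \<Rightarrow> complex" where
  "congr M A F i j = (\<Sum>p<M. \<Sum>q<M. A i p * F p q * cnj (A j q))"

lemma psd_iff_pos_form: "psd n A \<longleftrightarrow> A \<in> carrier_mat n n \<and> pos_form n (\<lambda>i j. A $$ (i, j))"
proof (cases "A \<in> carrier_mat n n")
  case True
  have eq: "(A *\<^sub>v vec n w) \<bullet>c vec n w = qform n (\<lambda>i j. A $$ (i, j)) w" for w
    using True by (auto simp: qform_def scalar_prod_def sum_distrib_right sum_distrib_left lessThan_atLeast0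
      mult_ac intro!: sum.cong)
  have "(\<forall>v\<in>carrier_vec n. 0 \<le> (A *\<^sub>v v) \<bullet>c v) \<longleftrightarrow> (\<forall>w. 0 \<le> (A *\<^sub>v vec n w) \<bullet>c vec n w)"
  proof safe
    fix v :: "complex vec" assume *: "\<forall>w. 0 \<le> (A *\<^sub>v vec n w) \<bullet>c vec n w" "v \<in> carrier_vec n"
    have "vec n (($) v) = v" using *(2) by auto
    then show "0 \<le> (A *\<^sub>v v) \<bullet>c v" using *(1) by metis
  qed auto
  then show ?thesis using True by (simp add: psd_def pos_form_def eq)
qed (simp add: psd_def)

lemma qform_cong:
  "(\<And>i j. i < N \<Longrightarrow> j < N \<Longrightarrow> F i j = G i j) \<Longrightarrow> qform N F w = qform N G w"
  by (simp add: qform_def)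

lemma pos_form_cong:
  assumes "pos_form N F" "\<And>i j. i < N \<Longrightarrow> j < N \<Longrightarrow> F i j = G i j"
  shows "pos_form N G"
  using assms(1) qform_cong[of N F G, OF assms(2)] by (simp add: pos_form_def)

text \<open>The form of the congruent matrix at \<open>w\<close> is the form of \<open>F\<close> at
  the image of \<open>w\<close> under the adjoint of \<open>A\<close>.\<close>

lemma pos_form_congruence:
  assumes "pos_form M F"
  shows "pos_form N (congr M A F)"
  unfolding pos_form_def
proof
  fix w
  have "qform N (congr M A F) w = (\<Sum>i<N. \<Sum>j<N. \<Sum>p<M. \<Sum>q<M. A i p * F p q * cnj (A j q) * w j * cnj (w i))"
    by (simp add: qform_def congr_def sum_distrib_right)
  also have "\<dots> = (\<Sum>i<N. \<Sum>p<M. \<Sum>j<N. \<Sum>q<M. A i p * F p q * cnj (A j q) * w j * cnj (w i))"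
    by (rule sum.cong[OF refl], rule sum.swap)
  also have "\<dots> = (\<Sum>p<M. \<Sum>i<N. \<Sum>j<N. \<Sum>q<M. A i p * F p q * cnj (A j q) * w j * cnj (w i))"
    by (rule sum.swap)
  also have "\<dots> = (\<Sum>p<M. \<Sum>i<N. \<Sum>q<M. \<Sum>j<N. A i p * F p q * cnj (A j q) * w j * cnj (w i))"
    by (rule sum.cong[OF refl], rule sum.cong[OF refl], rule sum.swap)
  also have "\<dots> = (\<Sum>p<M. \<Sum>q<M. \<Sum>i<N. \<Sum>j<N. A i p * F p q * cnj (A j q) * w j * cnj (w i))"
    by (rule sum.cong[OF refl], rule sum.swap)
  also have "\<dots> = qform M F (\<lambda>q. \<Sum>j<N. cnj (A j q) * w j)"
    unfolding qform_def cnj_sum sum_distrib_left sum_distrib_right 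
    by (intro sum.cong refl) (simp add: sum_distrib_left sum_distrib_right mult_ac)
  finally show "0 \<le> qform N (congr M A F) w" using assms by (simp add: pos_form_def)
qed

text \<open>Serves to undo a change of basis: for mutually inverse \<open>T\<close> and
  \<open>S\<close> the combined factor is the identity and \<open>congr_identity\<close>
  applies.\<close>

lemma congr_compose:
  "congr N T (congr M S F) i j = congr M (\<lambda>i p. \<Sum>t<N. T i t * S t p) F i j"
proof -
  have "congr N T (congr M S F) i j =
      (\<Sum>t<N. \<Sum>s<N. \<Sum>p<M. \<Sum>q<M. T i t * S t p * F p q * cnj (T j s) * cnj (S s q))"
    unfolding congr_def sum_distrib_left sum_distrib_right 
    by (intro sum.cong refl) (simp add: mult_ac)
  also have "\<dots> = (\<Sum>t<N. \<Sum>p<M. \<Sum>s<N. \<Sum>q<M. T i t * S t p * F p q * cnj (T j s) * cnj (S s q))"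
    by (rule sum.cong[OF refl], rule sum.swap)
  also have "\<dots> = (\<Sum>p<M. \<Sum>t<N. \<Sum>s<N. \<Sum>q<M. T i t * S t p * F p q * cnj (T j s) * cnj (S s q))"
    by (rule sum.swap)
  also have "\<dots> = (\<Sum>p<M. \<Sum>t<N. \<Sum>q<M. \<Sum>s<N. T i t * S t p * F p q * cnj (T j s) * cnj (S s q))"
    by (rule sum.cong[OF refl], rule sum.cong[OF refl], rule sum.swap)
  also have "\<dots> = (\<Sum>p<M. \<Sum>q<M. \<Sum>t<N. \<Sum>s<N. T i t * S t p * F p q * cnj (T j s) * cnj (S s q))"
    by (rule sum.cong[OF refl], rule sum.swap)
  also have "\<dots> = congr M (\<lambda>i p. \<Sum>t<N. T i t * S t p) F i j"
    unfolding congr_def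
  proof (intro sum.cong refl)
    fix p q
    have "(\<Sum>t<N. \<Sum>s<N. T i t * S t p * F p q * cnj (T j s) * cnj (S s q)) =
        F p q * (\<Sum>t<N. \<Sum>s<N. (T i t * S t p) * cnj (T j s * S s q))"
      by (simp add: sum_distrib_left mult_ac)
    also have "\<dots> = (\<Sum>t<N. T i t * S t p) * F p q * cnj (\<Sum>s<N. T j s * S s q)"
      unfolding sum_product[symmetric] cnj_sum by (simp add: mult_ac)
    finally show "(\<Sum>t<N. \<Sum>s<N. T i t * S t p * F p q * cnj (T j s) * cnj (S s q)) =
        (\<Sum>t<N. T i t * S t p) * F p q * cnj (\<Sum>s<N. T j s * S s q)" .
  qed
  finally show ?thesis .
qed

lemma congr_identity:
  assumes "\<And>p. p < M \<Longrightarrow> A i p = of_bool (p = i)" "\<And>p. p < M \<Longrightarrow> A j p = of_bool (p = j)"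
    "i < M" "j < M"
  shows "congr M A F i j = F i j"
proof -
  have "congr M A F i j = (\<Sum>p<M. \<Sum>q<M. if q = j then (if p = i then F p q else 0) else 0)"
    unfolding congr_def by (intro sum.cong refl) (use assms in auto)
  then show ?thesis using assms(3,4) by simp
qed

lemma congr_sum:
  "congr M A (\<lambda>p q. \<Sum>b\<in>I. F b p q) i j = (\<Sum>b\<in>I. congr M A (F b) i j)"
proof -
  have "congr M A (\<lambda>p q. \<Sum>b\<in>I. F b p q) i j = (\<Sum>p<M. \<Sum>q<M. \<Sum>b\<in>I. A i p * F b p q * cnj (A j q))"
    by (simp add: congr_def sum_distrib_left sum_distrib_right)
  also have "\<dots> = (\<Sum>p<M. \<Sum>b\<in>I. \<Sum>q<M. A i p * F b p q * cnj (A j q))"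
    by (rule sum.cong[OF refl], rule sum.swap)
  also have "\<dots> = (\<Sum>b\<in>I. congr M A (F b) i j)"
    unfolding congr_def by (rule sum.swap)
  finally show ?thesis .
qed

lemma congr_cong:
  assumes "\<And>p q. p < M \<Longrightarrow> q < M \<Longrightarrow> F p q = G p q"
    "\<And>p. p < M \<Longrightarrow> A i p = B i p" "\<And>p. p < M \<Longrightarrow> A j p = B j p"
  shows "congr M A F i j = congr M B G i j"
  using assms by (simp add: congr_def)

lemma qform_sum: "qform N (\<lambda>i j. \<Sum>b\<in>I. F b i j) w = (\<Sum>b\<in>I. qform N (F b) w)"
proof -
  have "qform N (\<lambda>i j. \<Sum>b\<in>I. F b i j) w = (\<Sum>i<N. \<Sum>j<N. \<Sum>b\<in>I. F b i j * w j * cnj (w i))"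
    by (simp add: qform_def sum_distrib_right)
  also have "\<dots> = (\<Sum>i<N. \<Sum>b\<in>I. \<Sum>j<N. F b i j * w j * cnj (w i))"
    by (rule sum.cong[OF refl], rule sum.swap)
  also have "\<dots> = (\<Sum>b\<in>I. qform N (F b) w)"
    unfolding qform_def by (rule sum.swap)
  finally show ?thesis .
qed

lemma pos_form_sum:
  assumes "\<And>b. b \<in> I \<Longrightarrow> pos_form N (F b)"
  shows "pos_form N (\<lambda>i j. \<Sum>b\<in>I. F b i j)"
  using assms by (auto simp: pos_form_def qform_sum intro: sum_nonneg)

lemma qform_add: "qform N (\<lambda>i j. F i j + G i j) w = qform N F w + qform N G w"
  by (simp add: qform_def sum.distrib ring_distribs)

lemma complex_mult_cnj_nonneg: "0 \<le> z * cnj z"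
  by (simp add: complex_mult_cnj less_eq_complex_def)

lemma pos_form_rank_one: "pos_form N (\<lambda>i j. z i * cnj (z j))"
proof -
  have "qform N (\<lambda>i j. z i * cnj (z j)) w = (\<Sum>j<N. cnj (z j) * w j) * cnj (\<Sum>j<N. cnj (z j) * w j)" for w
    unfolding qform_def cnj_sum sum_product by (subst sum.swap) (simp add: mult_ac)
  then show ?thesis by (simp only: pos_form_def complex_mult_cnj_nonneg simp_thms)
qed

lemma qform_diagonal:
  "qform N (\<lambda>i j. of_bool (i = j) * D i) w = (\<Sum>i<N. D i * (w i * cnj (w i)))"
proof -
  have "qform N (\<lambda>i j. of_bool (i = j) * D i) w = (\<Sum>i<N. \<Sum>j<N. if j = i then D i * (w i * cnj (w i)) else 0)"
    unfolding qform_def by (intro sum.cong refl) auto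
  then show ?thesis by simp
qed

lemma pos_form_diagonal:
  assumes "\<And>i. i < N \<Longrightarrow> 0 \<le> D i"
  shows "pos_form N (\<lambda>i j. of_bool (i = j) * D i)"
  unfolding pos_form_def qform_diagonal
  using assms by (auto intro!: sum_nonneg mult_nonneg_nonneg complex_mult_cnj_nonneg)

text \<open>Reindexing is a congruence with a 0/1 matrix, where \<open>f\<close> may be
  non-injective. Transposing a form amounts to conjugating the vector at which it is
  evaluated.\<close>

lemma pos_form_reindex_transpose:
  assumes K: "pos_form M K" and f: "\<And>i. i < N \<Longrightarrow> f i < M"
  shows "pos_form N (\<lambda>i j. K (f j) (f i))"
proof -
  let ?A = "\<lambda>i p. of_bool (p = f i)"
  have eq: "congr M ?A K i j = K (f i) (f j)" if "i < N" "j < N" for i j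
  proof -
    have "congr M ?A K i j = (\<Sum>p<M. \<Sum>q<M. if q = f j then (if p = f i then K p q else 0) else 0)"
      unfolding congr_def by (intro sum.cong refl) auto
    then show ?thesis using that f by simp
  qed
  have "pos_form N (\<lambda>i j. K (f i) (f j))"
    using pos_form_congruence[OF K, of N ?A] by (rule pos_form_cong) (simp add: eq)
  moreover have "qform N (\<lambda>i j. K (f j) (f i)) w = qform N (\<lambda>i j. K (f i) (f j)) (\<lambda>i. cnj (w i))" for w
    unfolding qform_def by (subst sum.swap) (simp add: mult_ac)
  ultimately show ?thesis by (simp add: pos_form_def)
qed

section \<open>Test vectors, polarization and the entries of positive forms\<close>

lemma qform_two_point:
  assumes "i < N" "j < N" "i \<noteq> j"
  shows "qform N F (\<lambda>t. if t = i then x else if t = j then y else 0) =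
    F i i * x * cnj x + F i j * y * cnj x + F j i * x * cnj y + F j j * y * cnj y"
proof -
  let ?w = "\<lambda>t. if t = i then x else if t = j then y else 0"
  have "(\<Sum>q<N. F p q * ?w q * cnj (?w p)) = (\<Sum>q\<in>{i,j}. F p q * ?w q * cnj (?w p))" for p
    by (rule sum.mono_neutral_right) (use assms in auto)
  then have "qform N F ?w = (\<Sum>p<N. \<Sum>q\<in>{i,j}. F p q * ?w q * cnj (?w p))"
    by (simp add: qform_def)
  also have "\<dots> = (\<Sum>p\<in>{i,j}. \<Sum>q\<in>{i,j}. F p q * ?w q * cnj (?w p))"
    by (rule sum.mono_neutral_right) (use assms in auto)
  finally show ?thesis using assms by simp
qed

lemma qform_one_point:
  assumes "i < N"
  shows "qform N F (\<lambda>t. if t = i then x else 0) = F i i * x * cnj x"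
proof -
  have "qform N F (\<lambda>t. if t = i then x else 0) =
      (\<Sum>p<N. \<Sum>q<N. if q = i then (if p = i then F i i * x * cnj x else 0) else 0)"
    unfolding qform_def by (intro sum.cong refl) auto
  then show ?thesis using assms by simp
qed

text \<open>Evaluation at basis vectors kills the diagonal; evaluation at e_i + e_j and at e_i +
  \<i> e_j gives the sum and the difference of the two mirrored entries.\<close>

lemma polarization_zero:
  assumes "\<And>w. qform N F w = 0" "i < N" "j < N"
  shows "F i j = 0"
proof -
  have diag: "F p p = 0" if "p < N" for p
    using assms(1)[of "\<lambda>t. if t = p then 1 else 0"] qform_one_point[OF that, of F 1] by simp
  show ?thesis
  proof (cases "i = j")
    case False
    have "F i j + F j i = 0"
      using assms(1) qform_two_point[OF assms(2,3) False, of F 1 1] diag assms by simp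
    moreover have "F i j * \<i> - F j i * \<i> = 0"
      using assms(1) qform_two_point[OF assms(2,3) False, of F 1 \<i>] diag assms by simp
    then have "(F i j - F j i) * \<i> = 0" by (simp add: ring_distribs)
    then have "F i j = F j i" by simp
    ultimately show ?thesis by simp
  qed (use diag assms in simp)
qed

text \<open>A positive form takes real values, so the difference of \<open>F\<close> and its adjoint
  has zero quadratic form and vanishes by polarization.\<close>

lemma pos_form_hermitian:
  assumes "pos_form N F" "i < N" "j < N"
  shows "F j i = cnj (F i j)"
proof -
  have "qform N (\<lambda>i j. F i j - cnj (F j i)) w = 0" for w
  proof -
    have "qform N (\<lambda>i j. F i j - cnj (F j i)) w = qform N F w - cnj (qform N F w)"
      unfolding qform_def cnj_sum
      by (subst (3) sum.swap) (simp add: sum_subtractf ring_distribs mult_ac)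
    moreover have "0 \<le> qform N F w" using assms(1) by (simp add: pos_form_def)
    ultimately show ?thesis by (simp add: complex_eq_iff less_eq_complex_def)
  qed
  from polarization_zero[OF this assms(3,2)] show ?thesis by simp
qed

lemma pos_form_diag_nonneg:
  assumes "pos_form N F" "i < N"
  shows "0 \<le> F i i"
  using assms(1) qform_one_point[OF assms(2), of F 1] unfolding pos_form_def
  by (metis complex_cnj_one mult.right_neutral)

text \<open>Along the vectors e_i - t cnj (F i j) e_j the form is affine in t with slope -2 |F i
  j|^2, which positivity for all t forces to be 0.\<close>

lemma pos_form_zero_diag:
  assumes F: "pos_form N F" and "i < N" "j < N" and zero: "F j j = 0"
  shows "F i j = 0"
proof (cases "i = j")
  case False
  define z where "z = F i j"
  have "0 \<le> Re (F i i) - 2 * t * (cmod z)\<^sup>2" for t :: real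
  proof -
    have "F j i = cnj z" using pos_form_hermitian[OF F assms(2,3)] by (simp add: z_def)
    then have "qform N F (\<lambda>s. if s = i then 1 else if s = j then - of_real t * cnj z else 0)
        = F i i - of_real (2 * t) * (z * cnj z)"
      using qform_two_point[OF assms(2,3) False, of F 1 "- of_real t * cnj z"] zero
      by (simp add: z_def)
    also have "\<dots> = F i i - of_real (2 * t * (cmod z)\<^sup>2)"
      using complex_norm_square[of z] by simp
    finally show ?thesis
      using F by (metis (no_types, lifting) Re_complex_of_real minus_complex.sel(1) pos_form_def
        less_eq_complex_def zero_complex.sel(1))
  qed
  \<comment> \<open>For nonzero \<open>z\<close> this value of t would give 0 \<le> -1.\<close>
  from this[of "(Re (F i i) + 1) / (2 * (cmod z)\<^sup>2)"] have "z = 0"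
    by (cases "z = 0") (auto simp: field_simps)
  then show ?thesis by (simp add: z_def)
qed (use zero in simp)

subsection \<open>A Radon-Nikodym theorem\<close>

text \<open>Induction on the dimension: \<open>F'\<close> is the Schur complement of the last diagonal entry \<open>c\<close>.
  If \<open>c = 0\<close>, the last row and column vanish and division by zero makes \<open>F' = F\<close>.\<close>

lemma pos_form_factorization:
  assumes "pos_form N F"
  shows "\<exists>S T e. (\<forall>i<N. \<forall>j<N. (\<Sum>t<N. S i t * T t j) = of_bool (i = j)) \<and>
    (\<forall>i<N. \<forall>j<N. (\<Sum>t<N. T i t * S t j) = of_bool (i = j)) \<and>
    (\<forall>i<N. e i \<in> {0, 1 :: complex}) \<and>
    (\<forall>i<N. \<forall>j<N. F i j = (\<Sum>t<N. T i t * e t * cnj (T j t)))"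
  using assms
proof (induction N arbitrary: F)
  case (Suc N)
  define c where "c = F N N"
  \<comment> \<open>For \<open>c = 0\<close> the value 1 keeps \<open>T1\<close> below invertible;
    the vanishing pivot is recorded by \<open>e1 N = 0\<close>.\<close>
  define s :: complex where "s = (if c = 0 then 1 else of_real (sqrt (Re c)))"
  have c: "0 \<le> c" unfolding c_def using pos_form_diag_nonneg[OF Suc.prems] by simp
  have s0: "s \<noteq> 0" using c by (auto simp: s_def less_eq_complex_def complex_eq_iff)
  have ss: "c \<noteq> 0 \<Longrightarrow> s * s = c"
    using c by (auto simp: s_def less_eq_complex_def complex_eq_iff)
  have cnjs: "cnj s = s" by (simp add: s_def)
  have cnjc: "cnj c = c" using c by (simp add: complex_eq_iff less_eq_complex_def)
  have herm: "i \<le> N \<Longrightarrow> cnj (F i N) = F N i" for i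
    using pos_form_hermitian[OF Suc.prems, of i N] by simp
  have null: "c = 0 \<Longrightarrow> i \<le> N \<Longrightarrow> F i N = 0" for i
    using pos_form_zero_diag[OF Suc.prems, of i N] by (simp add: c_def)
  \<comment> \<open>Gaussian elimination: a multiple of row \<open>N\<close> is subtracted from row
    \<open>i\<close>, so the congruence with \<open>A\<close> has the Schur complement
    \<open>F'\<close> as its entries below \<open>N\<close>.\<close>
  define A where "A i p = of_bool (p = i) - of_bool (p = N) * (F i N / c)" for i p
  define F' where "F' i j = F i j - F i N * F N j / c" for i j
  have "pos_form N (congr (Suc N) A F)"
    by (rule pos_form_congruence) (rule Suc.prems)
  moreover have "congr (Suc N) A F i j = F' i j" if "i < N" "j < N" for i j
  proof -
    have row: "(\<Sum>q<Suc N. g q * cnj (A j q)) = g j - g N * (F N j / c)" for g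
    proof -
      have "(\<Sum>q<N. g q * cnj (A j q)) = (\<Sum>q<N. if q = j then g q else 0)"
        by (rule sum.cong) (auto simp: A_def)
      moreover have "cnj (A j N) = - (F N j / c)" using that herm[of j] cnjc by (simp add: A_def)
      ultimately show ?thesis using that by simp
    qed
    have col: "(\<Sum>p<Suc N. A i p * g p) = g i - (F i N / c) * g N" for g
    proof -
      have "(\<Sum>p<N. A i p * g p) = (\<Sum>p<N. if p = i then g p else 0)"
        by (rule sum.cong) (auto simp: A_def)
      then show ?thesis using that by (simp add: A_def)
    qed
    have "congr (Suc N) A F i j = (\<Sum>p<Suc N. A i p * (\<Sum>q<Suc N. F p q * cnj (A j q)))"
      by (simp only: congr_def sum_distrib_left mult.assoc)
    also have "\<dots> = F i j - F i N * (F N j / c) - (F i N / c) * (F N j - c * (F N j / c))"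
      unfolding row col by (simp only: c_def)
    also have "\<dots> = F' i j" using null[of i] that by (cases "c = 0") (auto simp: F'_def)
    finally show ?thesis .
  qed
  ultimately have "pos_form N F'" by (rule pos_form_cong)
  from Suc.IH[OF this] obtain S T e where
    ST: "\<forall>i<N. \<forall>j<N. (\<Sum>t<N. S i t * T t j) = of_bool (i = j)" and
    TS: "\<forall>i<N. \<forall>j<N. (\<Sum>t<N. T i t * S t j) = of_bool (i = j)" and
    e: "\<forall>i<N. e i \<in> {0, 1 :: complex}" and
    F': "\<forall>i<N. \<forall>j<N. F' i j = (\<Sum>t<N. T i t * e t * cnj (T j t))" by blast
  \<comment> \<open>\<open>T1\<close> is the block triangular matrix with diagonal blocks
    \<open>T\<close> and \<open>s\<close> and last column \<open>F i N / s\<close>;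
    \<open>S1\<close> is its inverse by block inversion. For nonzero \<open>c\<close> the last
    column contributes \<open>F i N * F N j / c\<close>, which restores \<open>F\<close> from
    \<open>F'\<close>.\<close>
  define T1 where "T1 i p = (if i = N then if p = N then s else 0
    else if p = N then F i N / s else T i p)" for i p
  define S1 where "S1 i p = (if i = N then if p = N then 1 / s else 0
    else if p = N then - (\<Sum>t<N. S i t * F t N) / (s * s) else S i p)" for i p
  define e1 where "e1 i = (if i = N then of_bool (c \<noteq> 0) else e i)" for i
  show ?case
  proof (rule exI[of _ S1], rule exI[of _ T1], rule exI[of _ e1], intro conjI allI impI)
    fix i j assume i: "i < Suc N" and j: "j < Suc N"
    show "(\<Sum>t<Suc N. S1 i t * T1 t j) = of_bool (i = j)"
    proof (cases "i = N"; cases "j = N")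
      assume "i \<noteq> N" "j = N"
      then have "(\<Sum>t<N. S1 i t * T1 t j) = (\<Sum>t<N. S i t * F t N) / s"
        by (simp add: S1_def T1_def sum_divide_distrib)
      then show ?thesis using \<open>i \<noteq> N\<close> \<open>j = N\<close> s0 by (simp add: S1_def T1_def)
    qed (use i j s0 ST in \<open>simp_all add: S1_def T1_def less_Suc_eq\<close>)
    show "(\<Sum>t<Suc N. T1 i t * S1 t j) = of_bool (i = j)"
    proof (cases "i = N"; cases "j = N")
      assume ij: "i \<noteq> N" "j = N"
      have "(\<Sum>t<N. T i t * (\<Sum>u<N. S t u * F u N)) = (\<Sum>u<N. (\<Sum>t<N. T i t * S t u) * F u N)"
        unfolding sum_distrib_left sum_distrib_right by (subst sum.swap) (simp add: mult_ac)
      also have "\<dots> = (\<Sum>u<N. if u = i then F u N else 0)"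
        using TS i ij by (intro sum.cong) auto
      also have "\<dots> = F i N" using i ij by simp
      finally have eq: "(\<Sum>t<N. T i t * (\<Sum>u<N. S t u * F u N)) = F i N" .
      have "(\<Sum>t<N. T1 i t * S1 t j) = (\<Sum>t<N. T i t * - (\<Sum>u<N. S t u * F u N)) / (s * s)"
        using ij unfolding sum_divide_distrib by (simp add: S1_def T1_def)
      also have "\<dots> = - F i N / (s * s)"
        by (simp add: sum_negf eq)
      finally have "(\<Sum>t<N. T1 i t * S1 t j) = - F i N / (s * s)" .
      then show ?thesis using ij s0 by (simp add: S1_def T1_def)
    qed (use i j s0 TS in \<open>simp_all add: S1_def T1_def less_Suc_eq\<close>)
    show "e1 i \<in> {0, 1}" using e i by (auto simp: e1_def)
    show "F i j = (\<Sum>t<Suc N. T1 i t * e1 t * cnj (T1 j t))"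
    proof (cases "i = N"; cases "j = N")
      assume "i \<noteq> N" "j \<noteq> N"
      then have ij: "i < N" "j < N" using i j by auto
      then have "(\<Sum>t<N. T1 i t * e1 t * cnj (T1 j t)) = F' i j"
        using F' by (simp add: T1_def e1_def)
      then show ?thesis
        using ij herm[of j] cnjs ss by (cases "c = 0") (auto simp: T1_def e1_def F'_def)
    next
      assume "i = N" "j = N"
      then show ?thesis using ss cnjs by (cases "c = 0") (simp_all add: T1_def e1_def flip: c_def)
    next
      assume "i = N" "j \<noteq> N"
      then show ?thesis using null[of j] herm[of j] cnjs s0 j
        by (cases "c = 0") (auto simp: T1_def e1_def)
    next
      assume "i \<noteq> N" "j = N"
      then show ?thesis using null[of i] cnjs s0 i
        by (cases "c = 0") (auto simp: T1_def e1_def)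
    qed
  qed
qed simp

text \<open>With \<open>F = T e T\<^sup>*\<close> as above, the choice \<open>R = T e\<close> works, and the members of a
  decomposition of \<open>F\<close> turn into \<open>S (G a b) S\<^sup>*\<close>, which vanish off the support of \<open>e\<close> since
  they are positive and sum up to \<open>e\<close>.\<close>

lemma radon_nikodym:
  fixes l :: nat
  assumes F: "pos_form N F" and "l \<ge> 1"
    and G: "\<And>a b. a \<in> A \<Longrightarrow> b < l \<Longrightarrow> pos_form N (G a b)"
    and sumG: "\<And>a i j. a \<in> A \<Longrightarrow> i < N \<Longrightarrow> j < N \<Longrightarrow> (\<Sum>b<l. G a b i j) = F i j"
  shows "\<exists>R B. \<forall>a\<in>A. (\<forall>b<l. pos_form N (B a b)) \<and>
    (\<forall>i<N. \<forall>j<N. (\<Sum>b<l. B a b i j) = of_bool (i = j)) \<and>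
    (\<forall>b<l. \<forall>i<N. \<forall>j<N. G a b i j = congr N R (B a b) i j)"
proof -
  obtain S T e where
    ST: "\<forall>i<N. \<forall>j<N. (\<Sum>t<N. S i t * T t j) = of_bool (i = j)" and
    TS: "\<forall>i<N. \<forall>j<N. (\<Sum>t<N. T i t * S t j) = of_bool (i = j)" and
    e: "\<forall>i<N. e i \<in> {0, 1 :: complex}" and
    FT: "\<forall>i<N. \<forall>j<N. F i j = (\<Sum>t<N. T i t * e t * cnj (T j t))"
    using pos_form_factorization[OF F] by (elim exE conjE)
  let ?D = "\<lambda>i j. of_bool (i = j) * e i"
  \<comment> \<open>As \<open>S\<close> inverts \<open>T\<close>, the congruence with
    \<open>S\<close> turns \<open>F\<close> into the coordinate projection with diagonal
    \<open>e\<close>.\<close>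
  have SFS: "congr N S F i j = ?D i j" if "i < N" "j < N" for i j
  proof -
    have "congr N S F i j = congr N S (congr N T ?D) i j"
    proof (rule congr_cong)
      fix p q assume "p < N" "q < N"
      have "congr N T ?D p q = (\<Sum>t<N. \<Sum>u<N. if u = t then T p t * e t * cnj (T q t) else 0)"
        unfolding congr_def by (intro sum.cong refl) auto
      then show "F p q = congr N T ?D p q" using FT \<open>p < N\<close> \<open>q < N\<close> by simp
    qed auto
    also have "\<dots> = ?D i j"
      unfolding congr_compose by (rule congr_identity) (use ST that in auto)
    finally show ?thesis .
  qed
  define E where "E a b = congr N S (G a b)" for a b
  \<comment> \<open>The \<open>E a b\<close> only sum up to the projection \<open>e\<close>; its
    complement is assigned to outcome 0, which exists since \<open>l\<close> is at least 1.\<close>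
  define B where "B a b i j = E a b i j + of_bool (b = 0) * (of_bool (i = j) * (1 - e i))"
    for a and b :: nat and i j
  show ?thesis
  proof (rule exI[of _ "\<lambda>i t. T i t * e t"], rule exI[of _ B], intro ballI)
    fix a assume a: "a \<in> A"
    have E: "pos_form N (E a b)" if "b < l" for b
      unfolding E_def using G[OF a that] by (rule pos_form_congruence)
    have sumE: "(\<Sum>b<l. E a b i j) = ?D i j" if "i < N" "j < N" for i j
    proof -
      have "(\<Sum>b<l. E a b i j) = congr N S (\<lambda>p q. \<Sum>b<l. G a b p q) i j"
        by (simp add: E_def congr_sum)
      also have "\<dots> = congr N S F i j" by (rule congr_cong) (use sumG[OF a] in auto)
      finally show ?thesis using SFS that by simp
    qed
    \<comment> \<open>Where \<open>e j = 0\<close>, the nonnegative diagonal entries over all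
      \<open>b\<close> sum up to 0, so each is 0 and takes its whole column with it.\<close>
    have col0: "E a b i j = 0" if "b < l" "i < N" "j < N" "e j = 0" for b i j
    proof (rule pos_form_zero_diag[OF E])
      have "(\<Sum>b<l. E a b j j) = 0" using sumE that by simp
      then show "E a b j j = 0"
        using that pos_form_diag_nonneg[OF E] by (subst (asm) sum_nonneg_eq_0_iff) auto
    qed (use that in auto)
    have row0: "E a b i j = 0" if "b < l" "i < N" "j < N" "e i = 0" for b i j
      using pos_form_hermitian[OF E[OF that(1)] that(3,2)] col0[OF that(1,3,2,4)] by simp
    have "pos_form N (B a b)" if "b < l" for b
    proof -
      have "0 \<le> 1 - e i" if "i < N" for i using spec[OF e, of i] that by (auto simp: less_eq_complex_def)
      then have "pos_form N (\<lambda>i j. of_bool (i = j) * (of_bool (b = 0) * (1 - e i)))"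
        by (intro pos_form_diagonal) (simp add: of_bool_def)
      then show ?thesis
        using E[OF that] unfolding B_def pos_form_def
        by (simp add: qform_add mult.left_commute)
    qed
    moreover have "(\<Sum>b<l. B a b i j) = of_bool (i = j)" if "i < N" "j < N" for i j
    proof -
      have "(\<Sum>b<l. of_bool (b = 0) * x) = (\<Sum>b<l. if b = 0 then x else 0)" for x :: complex
        by (rule sum.cong) auto
      then show ?thesis
        using sumE[OF that] \<open>l \<ge> 1\<close> by (simp add: B_def sum.distrib)
    qed
    moreover have "G a b i j = congr N (\<lambda>i t. T i t * e t) (B a b) i j" if "b < l" "i < N" "j < N" for b i j
    proof -
      \<comment> \<open>The factors \<open>e\<close> annihilate the added complement, and they leave
        \<open>E\<close> unchanged because it vanishes off the support of \<open>e\<close>.\<close>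
      have "congr N (\<lambda>i t. T i t * e t) (B a b) i j = congr N T (E a b) i j"
        unfolding congr_def
      proof (intro sum.cong refl)
        fix p q assume "p \<in> {..<N}" "q \<in> {..<N}"
        then have "p < N" "q < N" by auto
        with spec[OF e, of p] spec[OF e, of q] col0[of b p q] row0[of b p q] \<open>b < l\<close>
        show "T i p * e p * B a b p q * cnj (T j q * e q) = T i p * E a b p q * cnj (T j q)"
          by (auto simp: B_def)
      qed
      also have "\<dots> = G a b i j"
        unfolding E_def congr_compose by (rule congr_identity) (use TS that in auto)
      finally show ?thesis by simp
    qed
    ultimately show "(\<forall>b<l. pos_form N (B a b)) \<and>
        (\<forall>i<N. \<forall>j<N. (\<Sum>b<l. B a b i j) = of_bool (i = j)) \<and>
        (\<forall>b<l. \<forall>i<N. \<forall>j<N. G a b i j = congr N (\<lambda>i t. T i t * e t) (B a b) i j)"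
      by blast
  qed
qed

subsection \<open>Completely positive maps and Choi matrices\<close>

lemma sum_lessThan_mult:
  "(\<Sum>P<m * n. f P) = (\<Sum>i<m. \<Sum>u<n. f (i * n + u))" for m n :: nat
proof -
  have "(\<Sum>P\<in>{i * n..<i * n + n}. f P) = (\<Sum>u<n. f (i * n + u))" for i
    by (rule sum.reindex_bij_witness[of _ "\<lambda>u. i * n + u" "\<lambda>P. P - i * n"]) auto
  then show ?thesis by (simp add: sum.nat_group[symmetric])
qed

lemma index_less: "i < m \<Longrightarrow> u < n \<Longrightarrow> i * n + u < m * n" for i m u n :: nat
proof -
  assume "i < m" "u < n"
  then have "i * n + u < Suc i * n" by simp
  also have "\<dots> \<le> m * n" using \<open>i < m\<close> by (intro mult_le_mono1) simp
  finally show ?thesis .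
qed

lemma index_div: "u < n \<Longrightarrow> (i * n + u) div n = i"
  and index_mod: "u < n \<Longrightarrow> (i * n + u) mod n = u" for i u n :: nat
  by simp_all

section \<open>Entries of sums, matrix units, tensor products and ampliations\<close>

lemma msum_carrier [simp]: "msum n f I \<in> carrier_mat n n"
  and msum_dim [simp]: "dim_row (msum n f I) = n" "dim_col (msum n f I) = n"
  and msum_index [simp]: "i < n \<Longrightarrow> j < n \<Longrightarrow> msum n f I $$ (i, j) = (\<Sum>t\<in>I. f t $$ (i, j))"
  by (simp_all add: msum_def)

lemma ketbra_carrier [simp]: "ketbra m i j \<in> carrier_mat m m"
  and ketbra_dim [simp]: "dim_row (ketbra m i j) = m" "dim_col (ketbra m i j) = m"
  and ketbra_index [simp]:
    "u < m \<Longrightarrow> v < m \<Longrightarrow> ketbra m i j $$ (u, v) = (if u = i \<and> v = j then 1 else 0)"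
  by (simp_all add: ketbra_def)

lemma kron_dim [simp]:
  "dim_row (A \<otimes>\<^sub>K B) = dim_row A * dim_row B" "dim_col (A \<otimes>\<^sub>K B) = dim_col A * dim_col B"
  by (simp_all add: kron_def)

lemma kron_index:
  "i < dim_row A * dim_row B \<Longrightarrow> j < dim_col A * dim_col B \<Longrightarrow> (A \<otimes>\<^sub>K B) $$ (i, j) =
    A $$ (i div dim_row B, j div dim_col B) * B $$ (i mod dim_row B, j mod dim_col B)"
  by (simp add: kron_def)

lemma index_div_less: "P < m * n \<Longrightarrow> P div n < m" for P m n :: nat
  by (simp add: less_mult_imp_div_less)

lemma index_mod_less: "P < m * n \<Longrightarrow> P mod n < n" for P m n :: nat
  by (metis mod_less_divisor mult_0_right not_gr_zero not_less_zero)

lemma ampliation_index: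
  assumes \<Phi>: "\<And>A. A \<in> carrier_mat m m \<Longrightarrow> \<Phi> A \<in> carrier_mat m' m'"
    and P: "P < p * m'" and Q: "Q < p * m'"
  shows "ampliation p m m' \<Phi> X $$ (P, Q) =
    \<Phi> (mat m m (\<lambda>(u, v). X $$ (P div m' * m + u, Q div m' * m + v))) $$ (P mod m', Q mod m')"
proof -
  let ?\<Phi> = "\<lambda>i j. \<Phi> (mat m m (\<lambda>(u, v). X $$ (i * m + u, j * m + v)))"
  have car: "?\<Phi> i j \<in> carrier_mat m' m'" for i j by (rule \<Phi>) simp
  have dims: "dim_row (?\<Phi> i j) = m'" "dim_col (?\<Phi> i j) = m'" for i j
    using car[of i j] by auto
  have "ampliation p m m' \<Phi> X $$ (P, Q) =
      (\<Sum>i<p. \<Sum>j<p. (ketbra p i j \<otimes>\<^sub>K ?\<Phi> i j) $$ (P, Q))"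
    using P Q by (simp add: ampliation_def sum.cartesian_product case_prod_unfold)
  also have "\<dots> = (\<Sum>i<p. \<Sum>j<p. if j = Q div m' then
      if i = P div m' then ?\<Phi> i j $$ (P mod m', Q mod m') else 0 else 0)"
    by (intro sum.cong refl, subst kron_index)
      (use P Q in \<open>auto simp: dims index_div_less\<close>)
  also have "\<dots> = ?\<Phi> (P div m') (Q div m') $$ (P mod m', Q mod m')"
    using P Q by (simp add: index_div_less)
  finally show ?thesis .
qed

lemma ampliation_carrier [simp]: "ampliation p m m' \<Phi> X \<in> carrier_mat (p * m') (p * m')"
  by (simp add: ampliation_def)

text \<open>The Kraus form: the sum over \<open>x\<close> in \<open>I\<close> of V_x^* X V_x with
  V_x of size \<open>m\<close> by \<open>n\<close>. A singleton \<open>I\<close> will give one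
  \<Lambda>, and all of \<open>{..<g}\<close> their sum.\<close>

definition compression ::
    "nat \<Rightarrow> nat \<Rightarrow> ('x \<Rightarrow> nat \<Rightarrow> nat \<Rightarrow> complex) \<Rightarrow> 'x set \<Rightarrow> complex mat \<Rightarrow> complex mat" where
  "compression m n V I X =
     mat n n (\<lambda>(u, v). \<Sum>x\<in>I. \<Sum>p<m. \<Sum>q<m. cnj (V x p u) * X $$ (p, q) * V x q v)"

text \<open>Ampliation turns V_x^* into its tensor product with the identity, which is the matrix
  \<open>A x\<close> below, so positivity reduces to a sum of congruences.\<close>

lemma completely_positive_compression: "completely_positive m n (compression m n V I)"
  unfolding completely_positive_def
proof (intro conjI allI impI)
  show "linear_map m n (compression m n V I)"
    unfolding linear_map_def
    by (auto simp: compression_def sum.distrib sum_distrib_left ring_distribs mult_ac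
      intro!: eq_matI sum.cong)
next
  fix p X assume X: "psd (p * m) X"
  define A where "A x P R = of_bool (R div m = P div n) * cnj (V x (R mod m) (P mod n))" for x P R
  have "pos_form (p * n) (\<lambda>P Q. \<Sum>x\<in>I. congr (p * m) (A x) (\<lambda>i j. X $$ (i, j)) P Q)"
    by (intro pos_form_sum pos_form_congruence) (use X in \<open>simp add: psd_iff_pos_form\<close>)
  moreover have "(\<Sum>x\<in>I. congr (p * m) (A x) (\<lambda>i j. X $$ (i, j)) P Q) =
      ampliation p m n (compression m n V I) X $$ (P, Q)" if "P < p * n" "Q < p * n" for P Q
  proof -
    have row: "(\<Sum>R<p * m. A x P R * h R) =
        (\<Sum>a<m. cnj (V x a (P mod n)) * h (P div n * m + a))" if "P < p * n" for x P h
    proof -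
      have "(\<Sum>R<p * m. A x P R * h R) = (\<Sum>i<p. if i = P div n then
          (\<Sum>a<m. cnj (V x a (P mod n)) * h (i * m + a)) else 0)"
        unfolding sum_lessThan_mult by (intro sum.cong refl) (auto simp: A_def intro!: sum.neutral)
      then show ?thesis using that by (simp add: index_div_less)
    qed
    have "congr (p * m) (A x) (\<lambda>i j. X $$ (i, j)) P Q =
        (\<Sum>a<m. \<Sum>b<m. cnj (V x a (P mod n)) *
          X $$ (P div n * m + a, Q div n * m + b) * V x b (Q mod n))" for x
    proof -
      have "congr (p * m) (A x) (\<lambda>i j. X $$ (i, j)) P Q =
          (\<Sum>R<p * m. A x P R * cnj (\<Sum>S<p * m. A x Q S * cnj (X $$ (R, S))))"
        by (simp add: congr_def sum_distrib_left mult_ac)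
      then show ?thesis
        unfolding row[OF that(1)] row[OF that(2)] by (simp add: sum_distrib_left mult_ac)
    qed
    then show ?thesis
      using that by (subst ampliation_index)
        (simp_all add: compression_def index_mod_less)
  qed
  ultimately show "psd (p * n) (ampliation p m n (compression m n V I) X)"
    unfolding psd_iff_pos_form by (auto elim: pos_form_cong)
qed

text \<open>Complete positivity is applied to the unnormalized maximally entangled projector
  \<open>\<Omega>\<close>, whose blocks are the matrix units. The input index comes first here,
  whereas \<open>choi\<close> puts the output first.\<close>

lemma pos_form_choi:
  assumes "completely_positive m m' \<Phi>"
  shows "pos_form (m * m')
    (\<lambda>P Q. \<Phi> (ketbra m (P div m') (Q div m')) $$ (P mod m', Q mod m'))"
proof -
  define \<Omega> :: "complex mat" where "\<Omega> = mat (m * m) (m * m)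
    (\<lambda>(P, Q). of_bool (P div m = P mod m) * cnj (of_bool (Q div m = Q mod m)))"
  have lin: "linear_map m m' \<Phi>" using assms by (simp add: completely_positive_def)
  have "psd (m * m) \<Omega>"
    unfolding psd_iff_pos_form
    using pos_form_cong[OF pos_form_rank_one[of "m * m" "\<lambda>P. of_bool (P div m = P mod m)"]]
    by (simp add: \<Omega>_def)
  then have "psd (m * m') (ampliation m m m' \<Phi> \<Omega>)"
    using assms by (simp add: completely_positive_def)
  then have "pos_form (m * m') (\<lambda>P Q. ampliation m m m' \<Phi> \<Omega> $$ (P, Q))"
    by (simp add: psd_iff_pos_form)
  then show ?thesis
  proof (rule pos_form_cong)
    fix P Q assume PQ: "P < m * m'" "Q < m * m'"
    have "mat m m (\<lambda>(u, v). \<Omega> $$ (P div m' * m + u, Q div m' * m + v)) =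
        ketbra m (P div m') (Q div m')"
      using PQ by (intro eq_matI) (auto simp: \<Omega>_def index_less index_div_less)
    then show "ampliation m m m' \<Phi> \<Omega> $$ (P, Q) =
        \<Phi> (ketbra m (P div m') (Q div m')) $$ (P mod m', Q mod m')"
      using PQ lin by (subst ampliation_index) (auto simp: linear_map_def)
  qed
qed

lemma linear_map_msum:
  assumes \<Phi>: "linear_map m m' \<Phi>" and "finite I" and f: "\<And>t. t \<in> I \<Longrightarrow> f t \<in> carrier_mat m m"
    and uv: "u < m'" "v < m'"
  shows "\<Phi> (msum m f I) $$ (u, v) = (\<Sum>t\<in>I. \<Phi> (f t) $$ (u, v))"
  using assms(2) f
proof (induction I rule: finite_induct)
  case empty
  \<comment> \<open>\<open>linear_map\<close> speaks of sums and multiples only, so the value at the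
    zero matrix comes from writing that matrix as 0 times itself.\<close>
  have "msum m f {} = 0 \<cdot>\<^sub>m msum m f {}" by (intro eq_matI) auto
  then have "\<Phi> (msum m f {}) = 0 \<cdot>\<^sub>m \<Phi> (msum m f {})"
    using \<Phi> unfolding linear_map_def by (metis msum_carrier)
  moreover have "\<Phi> (msum m f {}) \<in> carrier_mat m' m'"
    using \<Phi> by (simp add: linear_map_def)
  ultimately show ?case using uv
    by (metis carrier_matD index_smult_mat(1) mult_zero_left sum.empty)
next
  case (insert t I)
  have "msum m f (insert t I) = f t + msum m f I"
    using insert.hyps insert.prems[of t] by (intro eq_matI) auto
  moreover have "\<Phi> (f t + msum m f I) = \<Phi> (f t) + \<Phi> (msum m f I)"
    using \<Phi> insert.prems[of t] by (simp add: linear_map_def)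
  moreover have "\<Phi> (msum m f I) \<in> carrier_mat m' m'"
    using \<Phi> by (simp add: linear_map_def)
  ultimately show ?case using insert uv by auto
qed

lemma linear_map_expand:
  assumes \<Phi>: "linear_map m m' \<Phi>" and A: "A \<in> carrier_mat m m" and uv: "u < m'" "v < m'"
  shows "\<Phi> A $$ (u, v) = (\<Sum>i<m. \<Sum>j<m. A $$ (i, j) * \<Phi> (ketbra m i j) $$ (u, v))"
proof -
  have "A = msum m (\<lambda>(i, j). A $$ (i, j) \<cdot>\<^sub>m ketbra m i j) ({..<m} \<times> {..<m})"
  proof (rule eq_matI)
    fix u v assume "u < dim_row (msum m (\<lambda>(i, j). A $$ (i, j) \<cdot>\<^sub>m ketbra m i j) ({..<m} \<times> {..<m}))"
      "v < dim_col (msum m (\<lambda>(i, j). A $$ (i, j) \<cdot>\<^sub>m ketbra m i j) ({..<m} \<times> {..<m}))"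
    then have uv: "u < m" "v < m" by auto
    have "(\<Sum>i<m. \<Sum>j<m. (A $$ (i, j) \<cdot>\<^sub>m ketbra m i j) $$ (u, v)) =
        (\<Sum>i<m. \<Sum>j<m. if j = v then if i = u then A $$ (i, j) else 0 else 0)"
      by (intro sum.cong refl) (use uv in auto)
    then show "A $$ (u, v) =
        msum m (\<lambda>(i, j). A $$ (i, j) \<cdot>\<^sub>m ketbra m i j) ({..<m} \<times> {..<m}) $$ (u, v)"
      using uv by (simp add: sum.cartesian_product case_prod_unfold)
  qed (use A in auto)
  then have "\<Phi> A $$ (u, v) =
      \<Phi> (msum m (\<lambda>(i, j). A $$ (i, j) \<cdot>\<^sub>m ketbra m i j) ({..<m} \<times> {..<m})) $$ (u, v)"
    by simp
  also have "\<dots> = (\<Sum>t\<in>{..<m} \<times> {..<m}. \<Phi> ((\<lambda>(i, j). A $$ (i, j) \<cdot>\<^sub>m ketbra m i j) t) $$ (u, v))"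
    by (rule linear_map_msum[OF \<Phi>]) (use uv in auto)
  also have "\<dots> = (\<Sum>i<m. \<Sum>j<m. \<Phi> (A $$ (i, j) \<cdot>\<^sub>m ketbra m i j) $$ (u, v))"
    by (simp add: sum.cartesian_product case_prod_unfold)
  also have "\<dots> = (\<Sum>i<m. \<Sum>j<m. A $$ (i, j) * \<Phi> (ketbra m i j) $$ (u, v))"
  proof (intro sum.cong refl)
    fix i j
    have "\<Phi> (ketbra m i j) \<in> carrier_mat m' m'" using \<Phi> by (simp add: linear_map_def)
    moreover have "\<Phi> (A $$ (i, j) \<cdot>\<^sub>m ketbra m i j) = A $$ (i, j) \<cdot>\<^sub>m \<Phi> (ketbra m i j)"
      using \<Phi> by (simp add: linear_map_def)
    ultimately show "\<Phi> (A $$ (i, j) \<cdot>\<^sub>m ketbra m i j) $$ (u, v) =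
        A $$ (i, j) * \<Phi> (ketbra m i j) $$ (u, v)"
      using uv by auto
  qed
  finally show ?thesis .
qed

section \<open>Traces against matrix units and entries of Choi matrices\<close>

lemma mtrace_mult_ketbra:
  assumes "A \<in> carrier_mat m m" "i < m" "j < m"
  shows "mtrace (A * ketbra m i j) = A $$ (j, i)"
proof -
  have "(A * ketbra m i j) $$ (u, u) = (if u = j then A $$ (u, i) else 0)" if "u < m" for u
  proof -
    have "(A * ketbra m i j) $$ (u, u) = (\<Sum>t<m. A $$ (u, t) * (if t = i \<and> u = j then 1 else 0))"
      using assms(1) that by (simp add: scalar_prod_def lessThan_atLeast0)
    also have "\<dots> = (\<Sum>t<m. if t = i then if u = j then A $$ (u, t) else 0 else 0)"
      by (rule sum.cong) auto
    finally show ?thesis using assms(2) by simp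
  qed
  then show ?thesis using assms by (simp add: mtrace_def)
qed

lemma multimeter_channel_carrier [simp]: "multimeter_channel g k M \<sigma> \<in> carrier_mat k k"
  by (simp add: multimeter_channel_def)

text \<open>The trace against |I><J| reads off the entry (J, I); this is the origin of the
  transposed effects in the Choi matrix.\<close>

lemma multimeter_channel_ketbra:
  assumes M: "\<And>x. x < g \<Longrightarrow> M x b \<in> carrier_mat d d"
    and "I < d * g" "J < d * g" "b < k" "b' < k"
  shows "multimeter_channel g k M (ketbra (d * g) I J) $$ (b, b') =
    (if b = b' \<and> I mod g = J mod g then M (I mod g) b $$ (J div g, I div g) else 0)"
proof -
  let ?t = "\<lambda>x a. mtrace ((M x a \<otimes>\<^sub>K ketbra g x x) * ketbra (d * g) I J)"
  have "multimeter_channel g k M (ketbra (d * g) I J) $$ (b, b') =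
      (\<Sum>x<g. \<Sum>a<k. (?t x a \<cdot>\<^sub>m ketbra k a a) $$ (b, b'))"
    using assms by (simp add: multimeter_channel_def sum.cartesian_product case_prod_unfold)
  also have "\<dots> = (\<Sum>x<g. \<Sum>a<k. if a = b then if b = b' then ?t x a else 0 else 0)"
    by (intro sum.cong refl) (use assms in auto)
  also have "\<dots> = (\<Sum>x<g. if b = b' then ?t x b else 0)"
    using assms by simp
  also have "\<dots> = (\<Sum>x<g. if x = I mod g then
      if b = b' \<and> I mod g = J mod g then M x b $$ (J div g, I div g) else 0 else 0)"
  proof (intro sum.cong refl)
    fix x assume "x \<in> {..<g}"
    then have x: "x < g" by simp
    note Mx = M[OF x]
    have "?t x b = (M x b \<otimes>\<^sub>K ketbra g x x) $$ (J, I)"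
      using Mx by (intro mtrace_mult_ketbra carrier_matI assms) simp_all
    also have "\<dots> = M x b $$ (J div g, I div g) * ketbra g x x $$ (J mod g, I mod g)"
      using assms(2,3) Mx by (subst kron_index) auto
    finally show "(if b = b' then ?t x b else 0) = (if x = I mod g then
        if b = b' \<and> I mod g = J mod g then M x b $$ (J div g, I div g) else 0 else 0)"
      using x by (auto simp: index_mod_less)
  qed
  also have "\<dots> = (if b = b' \<and> I mod g = J mod g then M (I mod g) b $$ (J div g, I div g) else 0)"
    using index_mod_less[OF assms(2)] by simp
  finally show ?thesis .
qed

lemma choi_carrier [simp]: "choi m m' \<Phi> \<in> carrier_mat (m' * m) (m' * m)"
  by (simp add: choi_def)

lemma choi_index:
  assumes \<Phi>: "\<And>i j. \<Phi> (ketbra m i j) \<in> carrier_mat m' m'" and "P < m' * m" "Q < m' * m"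
  shows "choi m m' \<Phi> $$ (P, Q) = \<Phi> (ketbra m (P mod m) (Q mod m)) $$ (P div m, Q div m)"
proof -
  have dims: "dim_row (\<Phi> (ketbra m i j)) = m'" "dim_col (\<Phi> (ketbra m i j)) = m'" for i j
    using \<Phi>[of i j] by auto
  have "choi m m' \<Phi> $$ (P, Q) = (\<Sum>i<m. \<Sum>j<m. (\<Phi> (ketbra m i j) \<otimes>\<^sub>K ketbra m i j) $$ (P, Q))"
    using assms by (simp add: choi_def sum.cartesian_product case_prod_unfold)
  also have "\<dots> = (\<Sum>i<m. \<Sum>j<m. if j = Q mod m then if i = P mod m then
      \<Phi> (ketbra m i j) $$ (P div m, Q div m) else 0 else 0)"
    by (intro sum.cong refl, subst kron_index)
      (use assms in \<open>auto simp: dims index_mod_less\<close>)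
  finally show ?thesis using assms by (simp add: index_mod_less)
qed

text \<open>Separates the system from the ancilla: \<open>M\<close> enters linearly and
  \<open>B\<close> through a congruence whose rows are indexed by pairs of a system and an output
  index. This is the shape delivered by \<open>radon_nikodym\<close>.\<close>

lemma compression_kron_index:
  assumes "M \<in> carrier_mat d d" "B \<in> carrier_mat s s" "u < n" "v < n"
  shows "compression (d * s) n V I (M \<otimes>\<^sub>K B) $$ (u, v) =
    (\<Sum>x\<in>I. \<Sum>j<d. \<Sum>i<d. M $$ (j, i) *
      congr s (\<lambda>P t. cnj (V x (P div n * s + t) (P mod n))) (\<lambda>t t'. B $$ (t, t'))
        (j * n + u) (i * n + v))"
proof -
  have "compression (d * s) n V I (M \<otimes>\<^sub>K B) $$ (u, v) =
      (\<Sum>x\<in>I. \<Sum>j<d. \<Sum>t<s. \<Sum>i<d. \<Sum>t'<s. cnj (V x (j * s + t) u) *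
        (M $$ (j, i) * B $$ (t, t')) * V x (i * s + t') v)"
    using assms unfolding compression_def sum_lessThan_mult
    by (auto simp: kron_index index_less index_div index_mod intro!: sum.cong)
  also have "\<dots> = (\<Sum>x\<in>I. \<Sum>j<d. \<Sum>i<d. \<Sum>t<s. \<Sum>t'<s. cnj (V x (j * s + t) u) *
        (M $$ (j, i) * B $$ (t, t')) * V x (i * s + t') v)"
    by (rule sum.cong[OF refl], rule sum.cong[OF refl], rule sum.swap)
  finally show ?thesis
    using assms by (simp add: congr_def index_div index_mod sum_distrib_left mult_ac)
qed

subsection \<open>Choi matrices of multimeter channels\<close>

text \<open>The position of |a> \<otimes> |i> \<otimes> |x> in the order outcome, system, setting
  used by the Choi matrix of a multimeter channel.\<close>

definition triple_index :: "nat \<Rightarrow> nat \<Rightarrow> nat \<Rightarrow> nat \<Rightarrow> nat \<Rightarrow> nat" where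
  "triple_index d g a i x = a * (d * g) + (i * g + x)"

lemma triple_index_less: "a < k \<Longrightarrow> i < d \<Longrightarrow> x < g \<Longrightarrow> triple_index d g a i x < k * (d * g)"
  unfolding triple_index_def by (intro index_less)

lemma choi_multimeter_channel_index:
  assumes M: "\<And>x a. x < g \<Longrightarrow> a < k \<Longrightarrow> M x a \<in> carrier_mat d d"
    and "a < k" "i < d" "x < g" "a' < k" "i' < d" "x' < g"
  shows "choi (d * g) k (multimeter_channel g k M) $$ (triple_index d g a i x, triple_index d g a' i' x') =
    (if a = a' \<and> x = x' then M x a $$ (i', i) else 0)"
proof -
  have less: "i * g + x < d * g" "i' * g + x' < d * g"
    using assms by (auto intro: index_less)
  have decode: "triple_index d g a i x div (d * g) = a" "triple_index d g a i x mod (d * g) = i * g + x"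
    "triple_index d g a' i' x' div (d * g) = a'" "triple_index d g a' i' x' mod (d * g) = i' * g + x'"
    unfolding triple_index_def using less by (simp_all only: index_div index_mod)
  show ?thesis
    using assms less by (subst choi_index)
      (simp_all add: decode multimeter_channel_ketbra index_div index_mod triple_index_less)
qed

text \<open>The Choi matrix is block diagonal in the outcome and the setting, so of its expansion in
  matrix units only the terms with equal \<open>a\<close> and equal \<open>x\<close>
  survive.\<close>

lemma image_choi_index:
  assumes \<Psi>: "linear_map (k * d * g) m' \<Psi>"
    and M: "\<And>x a. x < g \<Longrightarrow> a < k \<Longrightarrow> M x a \<in> carrier_mat d d"
    and pq: "p < m'" "q < m'"
  shows "\<Psi> (choi (d * g) k (multimeter_channel g k M)) $$ (p, q) =
    (\<Sum>x<g. \<Sum>a<k. \<Sum>j<d. \<Sum>i<d. M x a $$ (j, i) *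
      \<Psi> (ketbra (k * d * g) (triple_index d g a i x) (triple_index d g a j x)) $$ (p, q))"
proof -
  define J where "J = choi (d * g) k (multimeter_channel g k M)"
  define f where "f P Q = \<Psi> (ketbra (k * d * g) P Q) $$ (p, q)" for P Q
  have split: "(\<Sum>P<k * d * g. h P) = (\<Sum>a<k. \<Sum>i<d. \<Sum>x<g. h (triple_index d g a i x))" for h :: "nat \<Rightarrow> complex"
    by (simp only: mult.assoc sum_lessThan_mult triple_index_def)
  have J: "J $$ (triple_index d g a i x, triple_index d g a' i' x') = (if a = a' \<and> x = x' then M x a $$ (i', i) else 0)"
    if "a < k" "i < d" "x < g" "a' < k" "i' < d" "x' < g" for a i x a' i' x'
    unfolding J_def using M that by (rule choi_multimeter_channel_index)
  have "\<Psi> J $$ (p, q) = (\<Sum>P<k * d * g. \<Sum>Q<k * d * g. J $$ (P, Q) * f P Q)"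
    unfolding f_def by (rule linear_map_expand[OF \<Psi> _ pq]) (simp add: J_def mult.assoc)
  also have "\<dots> = (\<Sum>a<k. \<Sum>i<d. \<Sum>x<g. \<Sum>a'<k. \<Sum>j<d. \<Sum>x'<g.
      J $$ (triple_index d g a i x, triple_index d g a' j x') * f (triple_index d g a i x) (triple_index d g a' j x'))"
    unfolding split ..
  also have "\<dots> = (\<Sum>a<k. \<Sum>i<d. \<Sum>x<g. \<Sum>j<d. M x a $$ (j, i) * f (triple_index d g a i x) (triple_index d g a j x))"
  proof (rule sum.cong[OF refl], rule sum.cong[OF refl], rule sum.cong[OF refl])
    fix a i x assume "a \<in> {..<k}" "i \<in> {..<d}" "x \<in> {..<g}"
    then have aix: "a < k" "i < d" "x < g" by auto
    have "(\<Sum>a'<k. \<Sum>j<d. \<Sum>x'<g. J $$ (triple_index d g a i x, triple_index d g a' j x') * f (triple_index d g a i x) (triple_index d g a' j x'))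
       = (\<Sum>a'<k. \<Sum>j<d. \<Sum>x'<g. if x' = x then if a' = a then
            M x a $$ (j, i) * f (triple_index d g a i x) (triple_index d g a j x) else 0 else 0)"
      by (intro sum.cong refl) (use aix in \<open>simp add: J\<close>)
    also have "\<dots> = (\<Sum>a'<k. if a' = a then
        (\<Sum>j<d. M x a $$ (j, i) * f (triple_index d g a i x) (triple_index d g a j x)) else 0)"
      by (rule sum.cong[OF refl]) (use aix in simp)
    finally show "(\<Sum>a'<k. \<Sum>j<d. \<Sum>x'<g.
        J $$ (triple_index d g a i x, triple_index d g a' j x') * f (triple_index d g a i x) (triple_index d g a' j x')) =
        (\<Sum>j<d. M x a $$ (j, i) * f (triple_index d g a i x) (triple_index d g a j x))"
      using aix by simp
  qed
  also have "\<dots> = (\<Sum>a<k. \<Sum>x<g. \<Sum>i<d. \<Sum>j<d. M x a $$ (j, i) * f (triple_index d g a i x) (triple_index d g a j x))"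
    by (rule sum.cong[OF refl], rule sum.swap)
  also have "\<dots> = (\<Sum>x<g. \<Sum>a<k. \<Sum>i<d. \<Sum>j<d. M x a $$ (j, i) * f (triple_index d g a i x) (triple_index d g a j x))"
    by (rule sum.swap)
  also have "\<dots> = (\<Sum>x<g. \<Sum>a<k. \<Sum>j<d. \<Sum>i<d. M x a $$ (j, i) * f (triple_index d g a i x) (triple_index d g a j x))"
    by (rule sum.cong[OF refl], rule sum.cong[OF refl], rule sum.swap)
  finally show ?thesis by (simp add: J_def f_def)
qed

lemma choi_multimeter_channel_cong:
  assumes "\<And>x a. x < g \<Longrightarrow> a < k \<Longrightarrow> M x a = N x a"
  shows "choi m k (multimeter_channel g k M) = choi m k (multimeter_channel g k N)"
proof -
  have "multimeter_channel g k M \<sigma> = multimeter_channel g k N \<sigma>" for \<sigma>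
    by (rule eq_matI)
      (auto simp: multimeter_channel_def assms intro!: sum.cong)
  then have "multimeter_channel g k M = multimeter_channel g k N" by blast
  then show ?thesis by simp
qed

subsection \<open>Independence of the outcome\<close>

text \<open>By Cauchy-Schwarz, w w^* is at most |w|^2 times the identity, so \<epsilon> = 1 / (1 +
  |w|^2) works; the summand 1 covers w = 0.\<close>

lemma rank_one_effect:
  obtains \<epsilon> :: real where "\<epsilon> > 0"
    "pos_form N (\<lambda>i j. \<epsilon> * (w i * cnj (w j)))"
    "pos_form N (\<lambda>i j. of_bool (i = j) - \<epsilon> * (w i * cnj (w j)))"
proof
  define W where "W = (L2_set (\<lambda>i. cmod (w i)) {..<N})\<^sup>2"
  define \<epsilon> where "\<epsilon> = 1 / (1 + W)"
  have W: "W \<ge> 0" by (simp add: W_def)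
  show pos: "\<epsilon> > 0" using W by (simp add: \<epsilon>_def add_nonneg_pos)
  define z where "z v = (\<Sum>j<N. cnj (w j) * v j)" for v
  have rank_one: "qform N (\<lambda>i j. \<epsilon> * (w i * cnj (w j))) v = of_real (\<epsilon> * (cmod (z v))\<^sup>2)" for v
  proof -
    have "qform N (\<lambda>i j. \<epsilon> * (w i * cnj (w j))) v = \<epsilon> * (z v * cnj (z v))"
    proof -
      have "z v * cnj (z v) = (\<Sum>j<N. \<Sum>i<N. cnj (w j) * v j * (w i * cnj (v i)))"
        unfolding z_def cnj_sum sum_product by simp
      then show ?thesis
        unfolding qform_def by (subst sum.swap) (simp add: sum_distrib_left mult_ac)
    qed
    then show ?thesis using complex_norm_square[of "z v"] by simp
  qed
  then show "pos_form N (\<lambda>i j. \<epsilon> * (w i * cnj (w j)))"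
    using pos by (simp add: pos_form_def less_eq_complex_def)
  show "pos_form N (\<lambda>i j. of_bool (i = j) - \<epsilon> * (w i * cnj (w j)))"
    unfolding pos_form_def
  proof
    fix v
    have "qform N (\<lambda>i j. of_bool (i = j) * 1) v = of_real (\<Sum>i<N. (cmod (v i))\<^sup>2)"
      unfolding qform_diagonal using complex_norm_square by simp
    moreover have "qform N (\<lambda>i j. of_bool (i = j) - \<epsilon> * (w i * cnj (w j))) v =
        qform N (\<lambda>i j. of_bool (i = j) * 1) v - qform N (\<lambda>i j. \<epsilon> * (w i * cnj (w j))) v"
      by (simp add: qform_def ring_distribs sum_subtractf)
    moreover have "\<epsilon> * (cmod (z v))\<^sup>2 \<le> (\<Sum>i<N. (cmod (v i))\<^sup>2)"
    proof -
      have "cmod (z v) \<le> (\<Sum>i<N. \<bar>cmod (w i)\<bar> * \<bar>cmod (v i)\<bar>)"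
        unfolding z_def by (rule order_trans[OF norm_sum]) (simp add: norm_mult)
      also have "\<dots> \<le> L2_set (\<lambda>i. cmod (w i)) {..<N} * L2_set (\<lambda>i. cmod (v i)) {..<N}"
        by (rule L2_set_mult_ineq)
      finally have "(cmod (z v))\<^sup>2 \<le>
          (L2_set (\<lambda>i. cmod (w i)) {..<N} * L2_set (\<lambda>i. cmod (v i)) {..<N})\<^sup>2"
        by (rule power_mono) simp
      also have "\<dots> = W * (\<Sum>i<N. (cmod (v i))\<^sup>2)"
        by (simp add: W_def power_mult_distrib L2_set_def sum_nonneg)
      also have "\<dots> \<le> (1 + W) * (\<Sum>i<N. (cmod (v i))\<^sup>2)"
        by (intro mult_right_mono sum_nonneg) auto
      finally show ?thesis using W by (simp add: \<epsilon>_def field_simps)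
    qed
    ultimately show "0 \<le> qform N (\<lambda>i j. of_bool (i = j) - \<epsilon> * (w i * cnj (w j))) v"
      by (simp add: rank_one less_eq_complex_def)
  qed
qed

text \<open>On a rank-one effect the functional is a positive multiple of the quadratic form of the
  coefficients, so polarization applies.\<close>

lemma functional_eq_0_if_effects_eq_0:
  assumes c: "\<And>P. pos_form d P \<Longrightarrow> pos_form d (\<lambda>i j. of_bool (i = j) - P i j) \<Longrightarrow>
      (\<Sum>j<d. \<Sum>i<d. P j i * c j i) = 0"
    and "i < d" "j < d"
  shows "c j i = 0"
proof (rule polarization_zero[of d "\<lambda>i j. c j i"])
  fix w
  obtain \<epsilon> :: real where \<epsilon>: "\<epsilon> > 0" and P: "pos_form d (\<lambda>i j. \<epsilon> * (w i * cnj (w j)))"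
    "pos_form d (\<lambda>i j. of_bool (i = j) - \<epsilon> * (w i * cnj (w j)))"
    by (rule rank_one_effect)
  have "\<epsilon> * qform d (\<lambda>i j. c j i) w = (\<Sum>j<d. \<Sum>i<d. (\<epsilon> * (w j * cnj (w i))) * c j i)"
    unfolding qform_def by (subst sum.swap) (simp add: sum_distrib_left mult_ac)
  with c[OF P] \<epsilon> show "qform d (\<lambda>i j. c j i) w = 0" by simp
qed (use assms in auto)

lemma outcome_independent:
  assumes const: "\<And>M. multimeter g k d M \<Longrightarrow>
      (\<Sum>x<g. \<Sum>a<k. \<Sum>j<d. \<Sum>i<d. M x a $$ (j, i) * C x a j i) = z"
    and x: "x < g" and a: "a < k" "a' < k" and ij: "i < d" "j < d"
  shows "C x a j i = (C x a' j i :: complex)"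
proof (cases "a = a'")
  case False
  \<comment> \<open>Every setting answers \<open>a'\<close> with certainty, except that at setting
    \<open>x\<close> the effect \<open>P\<close> is moved from \<open>a'\<close> to
    \<open>a\<close>. Comparison with \<open>P = 0\<close> isolates the pairing of \<open>P\<close>
    with the difference of the two coefficient families.\<close>
  define Z where "Z P x' b = mat d d (\<lambda>(j, i). of_bool (b = a') * of_bool (j = i) +
    of_bool (x' = x) * (of_bool (b = a) - of_bool (b = a')) * P j i)"
    for P :: "nat \<Rightarrow> nat \<Rightarrow> complex" and x' b :: nat
  have select: "(\<Sum>x'<g. \<Sum>b<k. of_bool (x' = x) * (of_bool (b = a) - of_bool (b = a')) * h x' b)
      = h x a - h x a'" for h :: "nat \<Rightarrow> nat \<Rightarrow> complex"
  proof -
    have "(\<Sum>b<k. of_bool (x' = x) * (of_bool (b = a) - of_bool (b = a')) * h x' b) =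
        (if x' = x then h x a - h x a' else 0)" for x'
    proof -
      have "(\<Sum>b<k. of_bool (x' = x) * (of_bool (b = a) - of_bool (b = a')) * h x' b) =
          of_bool (x' = x) * ((\<Sum>b<k. if b = a then h x b else 0) - (\<Sum>b<k. if b = a' then h x b else 0))"
        unfolding sum_subtractf[symmetric] sum_distrib_left by (rule sum.cong) auto
      then show ?thesis using a by simp
    qed
    then show ?thesis using x by simp
  qed
  have one: "pos_form d (\<lambda>i j. of_bool (i = j))"
    using pos_form_diagonal[of d "\<lambda>_. 1"] by (simp add: less_eq_complex_def)
  have zero: "pos_form d (\<lambda>i j. 0)" by (simp add: pos_form_def qform_def)
  have multi: "multimeter g k d (Z P)"
    if P: "pos_form d P" "pos_form d (\<lambda>i j. of_bool (i = j) - P i j)" for P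
    unfolding multimeter_def povm_def
  proof (intro allI impI conjI)
    fix x' b assume "x' < g" "b < k"
    have "pos_form d (\<lambda>j i. of_bool (b = a') * of_bool (j = i) +
        of_bool (x' = x) * (of_bool (b = a) - of_bool (b = a')) * P j i)"
      using P one zero False by (cases "x' = x"; cases "b = a"; cases "b = a'") auto
    then show "psd d (Z P x' b)"
      unfolding psd_iff_pos_form by (auto simp: Z_def elim: pos_form_cong)
  next
    fix x' assume "x' < g"
    show "msum d (Z P x') {..<k} = 1\<^sub>m d"
    proof (rule eq_matI)
      fix j i assume "j < dim_row (1\<^sub>m d :: complex mat)" "i < dim_col (1\<^sub>m d :: complex mat)"
      then have ji: "j < d" "i < d" by auto
      have "(\<Sum>b<k. Z P x' b $$ (j, i)) = (\<Sum>b<k. (if b = a' then of_bool (j = i) else 0) +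
          ((if b = a then of_bool (x' = x) * P j i else 0) -
           (if b = a' then of_bool (x' = x) * P j i else 0)))"
        by (rule sum.cong) (use ji in \<open>auto simp: Z_def\<close>)
      also have "\<dots> = of_bool (j = i)"
        using a by (simp add: sum.distrib sum_subtractf)
      finally show "msum d (Z P x') {..<k} $$ (j, i) = 1\<^sub>m d $$ (j, i)" using ji by simp
    qed auto
  qed
  have "C x a j i - C x a' j i = 0"
  proof (rule functional_eq_0_if_effects_eq_0[of d "\<lambda>j i. C x a j i - C x a' j i", OF _ ij])
    fix P assume P: "pos_form d P" "pos_form d (\<lambda>i j. of_bool (i = j) - P i j)"
    let ?S = "\<lambda>M. \<Sum>x<g. \<Sum>a<k. \<Sum>j<d. \<Sum>i<d. M x a $$ (j, i) * C x a j i"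
    have "?S (Z P) = ?S (Z (\<lambda>_ _. 0)) + (\<Sum>x'<g. \<Sum>b<k. of_bool (x' = x) *
        (of_bool (b = a) - of_bool (b = a')) * (\<Sum>j<d. \<Sum>i<d. P j i * C x' b j i))"
      unfolding sum_distrib_left sum.distrib[symmetric]
      by (intro sum.cong refl) (simp add: Z_def ring_distribs mult_ac)
    moreover have "?S (Z P) = ?S (Z (\<lambda>_ _. 0))"
      using const multi[OF P] multi[OF zero] one by simp
    ultimately show "(\<Sum>j<d. \<Sum>i<d. P j i * (C x a j i - C x a' j i)) = 0"
      unfolding select by (simp add: ring_distribs sum_subtractf)
  qed
  then show ?thesis by simp
qed simp

section \<open>Assembly of the ancilla, the dilations and the POVMs\<close>

theorem theorem4p1:
  fixes d n g r k l :: nat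
    and \<Psi> :: "complex mat \<Rightarrow> complex mat"
  assumes "d \<ge> 1" "n \<ge> 1" "g \<ge> 1" "r \<ge> 1" "k \<ge> 1" "l \<ge> 1"
    and "completely_positive (k * d * g) (l * n * r) \<Psi>"
    and "\<Psi> ` (choi (d * g) k ` MM g k d) \<subseteq> choi (n * r) l ` MM r l n"
  shows "\<exists>(s::nat) (\<Lambda> :: nat \<Rightarrow> nat \<Rightarrow> complex mat \<Rightarrow> complex mat)
            (B :: nat \<Rightarrow> nat \<Rightarrow> nat \<Rightarrow> nat \<Rightarrow> complex mat).
      s \<ge> 1 \<and>
      (\<forall>x<g. \<forall>y<r. completely_positive (d * s) n (\<Lambda> x y)) \<and>
      (\<forall>y<r. completely_positive (d * s) n (\<lambda>X. msum n (\<lambda>x. \<Lambda> x y X) {..<g}) \<and>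
             unital (d * s) n (\<lambda>X. msum n (\<lambda>x. \<Lambda> x y X) {..<g})) \<and>
      (\<forall>a<k. \<forall>x<g. \<forall>y<r. povm l s (B a x y)) \<and>
      (\<forall>M. multimeter g k d M \<longrightarrow>
        (let N = (\<lambda>y b. msum n (\<lambda>(x, a). \<Lambda> x y (M x a \<otimes>\<^sub>K B a x y b)) ({..<g} \<times> {..<k}))
         in multimeter r l n N \<and>
            \<Psi> (choi (d * g) k (multimeter_channel g k M)) =
              choi (n * r) l (multimeter_channel r l N)))"
proof -
  note cp = assms(7)
  have k: "0 < k" using \<open>k \<ge> 1\<close> by simp
  have lin: "linear_map (k * d * g) (l * n * r) \<Psi>"
    using cp by (simp add: completely_positive_def)
  \<comment> \<open>The Choi matrix of \<open>A \<mapsto>\<close> transposed diagonal block \<open>(b, y)\<close> of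
    \<open>\<Psi> (|a\<rangle>\<langle>a| \<otimes> A\<^sup>T \<otimes> |x\<rangle>\<langle>x|)\<close>; the two transpositions are those in the Choi matrices of
    multimeter channels.\<close>
  define F where "F x y a b P Q =
      \<Psi> (ketbra (k * d * g) (triple_index d g a (Q div n) x) (triple_index d g a (P div n) x)) $$
        (triple_index n r b (Q mod n) y, triple_index n r b (P mod n) y)" for x y a b P Q
  define C where "C x y a P Q = (\<Sum>b<l. F x y a b P Q)" for x y a P Q

  \<comment> \<open>\<open>F x y a b\<close> is a reindexed transpose of the Choi matrix of \<Psi>;
    swapping \<open>P\<close> and \<open>Q\<close> in its definition performs both transpositions at
    once.\<close>
  have F: "pos_form (d * n) (F x y a b)" if "x < g" "y < r" "a < k" "b < l" for x y a b
  proof -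
    let ?f = "\<lambda>P. triple_index d g a (P div n) x * (l * n * r) + triple_index n r b (P mod n) y"
    have less: "triple_index d g a (P div n) x < k * d * g" "triple_index n r b (P mod n) y < l * n * r"
      if "P < d * n" for P
      using triple_index_less[OF \<open>a < k\<close> index_div_less[OF that] \<open>x < g\<close>]
        triple_index_less[OF \<open>b < l\<close> index_mod_less[OF that] \<open>y < r\<close>] by (simp_all only: mult.assoc)
    show ?thesis
      by (rule pos_form_cong[OF pos_form_reindex_transpose[OF pos_form_choi[OF cp], of "d * n" ?f]])
        (simp_all only: less index_less index_div index_mod F_def)
  qed

  have multi_car: "M x a \<in> carrier_mat d d" if "multimeter g k d M" "x < g" "a < k" for M x a
    using that by (simp add: multimeter_def povm_def psd_def)

  \<comment> \<open>The range assumption only yields some \<open>N\<close>; its effects are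
    recovered from the diagonal blocks of the Choi matrix, with \<open>u\<close> and
    \<open>v\<close> exchanged.\<close>
  have image: "\<exists>N. multimeter r l n N \<and>
      \<Psi> (choi (d * g) k (multimeter_channel g k M)) = choi (n * r) l (multimeter_channel r l N) \<and>
      (\<forall>y<r. \<forall>b<l. \<forall>u<n. \<forall>v<n. N y b $$ (v, u) =
        (\<Sum>x<g. \<Sum>a<k. \<Sum>j<d. \<Sum>i<d. M x a $$ (j, i) * F x y a b (j * n + v) (i * n + u)))"
    if M: "multimeter g k d M" for M
  proof -
    obtain N where N: "multimeter r l n N" and
      eq: "\<Psi> (choi (d * g) k (multimeter_channel g k M)) = choi (n * r) l (multimeter_channel r l N)"
      using assms(8) M unfolding MM_def by fastforce
    have "N y b $$ (v, u) =
        (\<Sum>x<g. \<Sum>a<k. \<Sum>j<d. \<Sum>i<d. M x a $$ (j, i) * F x y a b (j * n + v) (i * n + u))"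
      if "y < r" "b < l" "u < n" "v < n" for y b u v
    proof -
      have "N y b $$ (v, u) =
          choi (n * r) l (multimeter_channel r l N) $$ (triple_index n r b u y, triple_index n r b v y)"
        using N that by (subst choi_multimeter_channel_index)
          (auto simp: multimeter_def povm_def psd_def)
      also have "\<dots> = (\<Sum>x<g. \<Sum>a<k. \<Sum>j<d. \<Sum>i<d. M x a $$ (j, i) *
          \<Psi> (ketbra (k * d * g) (triple_index d g a i x) (triple_index d g a j x)) $$ (triple_index n r b u y, triple_index n r b v y))"
        unfolding eq[symmetric]
        by (rule image_choi_index[OF lin])
          (use that multi_car[OF M] in \<open>simp_all add: triple_index_less mult.assoc\<close>)
      finally show ?thesis using that by (simp add: F_def index_div index_mod)
    qed
    then show ?thesis using N eq by blast
  qed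

  \<comment> \<open>Normalization of the image POVMs makes the total over \<open>b\<close> the same
    for all multimeters, as \<open>outcome_independent\<close> requires.\<close>
  have C_total: "(\<Sum>x<g. \<Sum>a<k. \<Sum>j<d. \<Sum>i<d. M x a $$ (j, i) * C x y a (j * n + v) (i * n + u)) =
      of_bool (v = u)" if M: "multimeter g k d M" and y: "y < r" and uv: "u < n" "v < n" for M y u v
  proof -
    obtain N where N: "multimeter r l n N" and NF: "\<forall>y<r. \<forall>b<l. \<forall>u<n. \<forall>v<n. N y b $$ (v, u) =
        (\<Sum>x<g. \<Sum>a<k. \<Sum>j<d. \<Sum>i<d. M x a $$ (j, i) * F x y a b (j * n + v) (i * n + u))"
      using image[OF M] by blast
    have "msum n (N y) {..<l} = 1\<^sub>m n" using N y by (simp add: multimeter_def povm_def)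
    then have "msum n (N y) {..<l} $$ (v, u) = of_bool (v = u)"
      using uv by simp
    then have "(\<Sum>b<l. N y b $$ (v, u)) = of_bool (v = u)"
      using uv by simp
    moreover have "(\<Sum>b<l. N y b $$ (v, u)) = (\<Sum>b<l. \<Sum>x<g. \<Sum>a<k. \<Sum>j<d. \<Sum>i<d.
        M x a $$ (j, i) * F x y a b (j * n + v) (i * n + u))"
      by (rule sum.cong) (use NF y uv in auto)
    moreover have "\<dots> = (\<Sum>x<g. \<Sum>a<k. \<Sum>j<d. \<Sum>i<d. \<Sum>b<l.
        M x a $$ (j, i) * F x y a b (j * n + v) (i * n + u))"
      by (rule trans[OF sum.swap sum.cong[OF refl]])+ (rule refl)
    ultimately show ?thesis by (simp add: C_def sum_distrib_left)
  qed

  \<comment> \<open>The output parts of \<open>P\<close> and \<open>Q\<close> are held fixed while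
    the system parts serve as the matrix indices of the functional. Outcome 0 is the
    reference.\<close>
  have C_indep: "C x y a P Q = C x y 0 P Q"
    if "x < g" "y < r" "a < k" "P < d * n" "Q < d * n" for x y a P Q
  proof -
    have "C x y a (P div n * n + P mod n) (Q div n * n + Q mod n) =
        C x y 0 (P div n * n + P mod n) (Q div n * n + Q mod n)"
      by (rule outcome_independent[where d = d and z = "of_bool (P mod n = Q mod n)" and C = 
            "\<lambda>x a j i. C x y a (j * n + P mod n) (i * n + Q mod n)"])
        (use C_total that k in \<open>auto simp: index_div_less index_mod_less\<close>)
    then show ?thesis by simp
  qed

  \<comment> \<open>The range conditions stand inside the existential so that choice gives total
    functions. \<open>R\<close> depends on \<open>x\<close> and \<open>y\<close> alone, which makes
    the dilation common to all outcomes.\<close>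
  have "\<forall>x. \<forall>y. \<exists>R B. x < g \<longrightarrow> y < r \<longrightarrow> (\<forall>a\<in>{..<k}. (\<forall>b<l. pos_form (d * n) (B a b)) \<and>
      (\<forall>i<d * n. \<forall>j<d * n. (\<Sum>b<l. B a b i j) = of_bool (i = j)) \<and>
      (\<forall>b<l. \<forall>i<d * n. \<forall>j<d * n. F x y a b i j = congr (d * n) R (B a b) i j))"
    (is "\<forall>x. \<forall>y. \<exists>R B. ?Q x y R B")
  proof (intro allI)
    fix x y
    show "\<exists>R B. ?Q x y R B"
    proof (cases "x < g \<and> y < r")
      case True
      have pos: "pos_form (d * n) (C x y 0)"
        unfolding C_def using True F k by (auto intro!: pos_form_sum)
      have sums: "(\<Sum>b<l. F x y a b i j) = C x y 0 i j"
        if "a \<in> {..<k}" "i < d * n" "j < d * n" for a i j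
        using C_indep[of x y a i j] True that by (simp add: C_def)
      have "\<exists>R B. \<forall>a\<in>{..<k}. (\<forall>b<l. pos_form (d * n) (B a b)) \<and>
          (\<forall>i<d * n. \<forall>j<d * n. (\<Sum>b<l. B a b i j) = of_bool (i = j)) \<and>
          (\<forall>b<l. \<forall>i<d * n. \<forall>j<d * n. F x y a b i j = congr (d * n) R (B a b) i j)"
        by (rule radon_nikodym[OF pos \<open>l \<ge> 1\<close> F sums]) (use True in auto)
      then obtain R B where "\<forall>a\<in>{..<k}. (\<forall>b<l. pos_form (d * n) (B a b)) \<and>
          (\<forall>i<d * n. \<forall>j<d * n. (\<Sum>b<l. B a b i j) = of_bool (i = j)) \<and>
          (\<forall>b<l. \<forall>i<d * n. \<forall>j<d * n. F x y a b i j = congr (d * n) R (B a b) i j)"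
        by (elim exE)
      then show ?thesis by (intro exI[of _ R] exI[of _ B] impI)
    qed auto
  qed
  then have "\<exists>R. \<forall>x. \<forall>y. \<exists>B. ?Q x y (R x y) B"
    by - (rule choice, rule allI, rule choice, erule spec)
  then obtain R where "\<forall>x. \<forall>y. \<exists>B. ?Q x y (R x y) B" ..
  then have "\<exists>B. \<forall>x. \<forall>y. ?Q x y (R x y) (B x y)"
    by - (rule choice, rule allI, rule choice, erule spec)
  then obtain B where RB: "\<forall>x. \<forall>y. ?Q x y (R x y) (B x y)" ..
  have B_pos: "pos_form (d * n) (B x y a b)" if "x < g" "y < r" "a < k" "b < l" for x y a b
    using RB that by simp
  have B_sum: "(\<Sum>b<l. B x y a b i j) = of_bool (i = j)"
    if "x < g" "y < r" "a < k" "i < d * n" "j < d * n" for x y a i j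
    using RB that by simp
  have FRB: "F x y a b i j = congr (d * n) (R x y) (B x y a b) i j"
    if "x < g" "y < r" "a < k" "b < l" "i < d * n" "j < d * n" for x y a b i j
    using RB that by simp

  define s where "s = d * n"
  \<comment> \<open>The rows of \<open>R\<close> are pairs of a system and an output index, its
    columns ancilla indices. Regrouping makes it the dilation from the output into system and
    ancilla, conjugated since \<open>compression\<close> conjugates its left factor.\<close>
  define V where "V y x p u = cnj (R x y (p div s * n + u) (p mod s))" for x y p u
  define \<Lambda> where "\<Lambda> x y = compression (d * s) n (V y) {x}" for x y
  define BB where "BB a x y b = mat s s (\<lambda>(t, t'). B x y a b t t')" for a x y b
  have V_block: "cnj (V y x (i * s + t) u) = R x y (i * n + u) t" if "t < s" for x y i t u
    using that by (simp add: V_def index_div index_mod)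
  have index_less_s: "i * n + u < s" if "i < d" "u < n" for i u
    unfolding s_def using that by (rule index_less)
  have \<Lambda>_sum: "msum n (\<lambda>x. \<Lambda> x y X) {..<g} = compression (d * s) n (V y) {..<g} X" for y X
    by (rule eq_matI) (auto simp: \<Lambda>_def compression_def)
  have \<Lambda>_kron: "\<Lambda> x y (M \<otimes>\<^sub>K BB a x y b) $$ (v, u) =
      (\<Sum>j<d. \<Sum>i<d. M $$ (j, i) * F x y a b (j * n + v) (i * n + u))"
    if "M \<in> carrier_mat d d" "x < g" "y < r" "a < k" "b < l" "u < n" "v < n" for M x y a b u v
  proof -
    have "congr s (\<lambda>P t. cnj (V y x (P div n * s + t) (P mod n))) (\<lambda>t t'. BB a x y b $$ (t, t'))
        (j * n + v) (i * n + u) = F x y a b (j * n + v) (i * n + u)" if "j < d" "i < d" for i j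
      using that \<open>x < g\<close> \<open>y < r\<close> \<open>a < k\<close> \<open>b < l\<close> \<open>u < n\<close> \<open>v < n\<close>
      by (subst FRB) (auto simp: index_less_s V_block BB_def index_div index_mod
        s_def[symmetric] intro!: congr_cong)
    moreover have "BB a x y b \<in> carrier_mat s s" by (simp add: BB_def)
    ultimately show ?thesis
      using that unfolding \<Lambda>_def by (subst compression_kron_index) auto
  qed

  show ?thesis
  proof (intro exI conjI allI impI)
    show "1 \<le> s" using \<open>d \<ge> 1\<close> \<open>n \<ge> 1\<close> by (simp add: s_def)
    show "completely_positive (d * s) n (\<Lambda> x y)" for x y
      unfolding \<Lambda>_def by (rule completely_positive_compression)
    show "completely_positive (d * s) n (\<lambda>X. msum n (\<lambda>x. \<Lambda> x y X) {..<g})" for y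
      unfolding \<Lambda>_sum by (rule completely_positive_compression)
    show "povm l s (BB a x y)" if "a < k" "x < g" "y < r" for a x y
      unfolding povm_def psd_iff_pos_form
      using that B_sum
      by (auto simp: BB_def s_def intro!: eq_matI pos_form_cong[OF B_pos])
  next
    fix y assume y: "y < r"
    \<comment> \<open>The multimeter that always answers 0 evaluates \<open>C x y 0\<close> at the
      identity, so \<open>C_total\<close> becomes the unitality of the summed map.\<close>
    define M :: "nat \<Rightarrow> nat \<Rightarrow> complex mat" where "M x a = of_bool (a = 0) \<cdot>\<^sub>m 1\<^sub>m d" for x a
    have "multimeter g k d M"
      unfolding multimeter_def povm_def psd_iff_pos_form
    proof (intro allI impI conjI)
      fix x a :: nat
      have "pos_form d (\<lambda>i j. of_bool (i = j) * of_bool (a = 0))"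
        by (rule pos_form_diagonal) (simp add: less_eq_complex_def)
      then show "pos_form d (\<lambda>i j. M x a $$ (i, j))"
        by (rule pos_form_cong) (simp add: M_def)
    next
      have "(\<Sum>a<k. of_bool (a = 0)) = (1 :: complex)"
        using k by (simp add: of_bool_def)
      then show "msum d (M x) {..<k} = 1\<^sub>m d" for x
        by (intro eq_matI) (simp_all add: M_def)
    qed (simp add: M_def)
    then have total: "(\<Sum>x<g. \<Sum>j<d. \<Sum>i<d. of_bool (j = i) * C x y 0 (j * n + v) (i * n + u)) =
        of_bool (v = u)" if "u < n" "v < n" for u v
    proof -
      have "(\<Sum>a<k. \<Sum>j<d. \<Sum>i<d. M x a $$ (j, i) * C x y a (j * n + v) (i * n + u)) =
          (\<Sum>a<k. if a = 0 then \<Sum>j<d. \<Sum>i<d. of_bool (j = i) * C x y a (j * n + v) (i * n + u) else 0)"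
        for x by (rule sum.cong) (auto simp: M_def of_bool_def intro!: sum.cong)
      then show ?thesis
        using C_total[OF \<open>multimeter g k d M\<close> y that] k by simp
    qed
    show "unital (d * s) n (\<lambda>X. msum n (\<lambda>x. \<Lambda> x y X) {..<g})"
      unfolding unital_def \<Lambda>_sum
    proof (rule eq_matI)
      fix v u assume "v < dim_row (1\<^sub>m n :: complex mat)" "u < dim_col (1\<^sub>m n :: complex mat)"
      then have uv: "v < n" "u < n" by auto
      have kron_one: "1\<^sub>m (d * s) = (1\<^sub>m d \<otimes>\<^sub>K 1\<^sub>m s :: complex mat)"
        by (rule eq_matI) (auto simp: kron_index index_div_less index_mod_less, (metis div_mult_mod_eq)+)
      \<comment> \<open>The ancilla identity is written as the sum of the POVM
        \<open>B x y 0\<close>, whose congruences with \<open>R\<close> add up to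
        \<open>C x y 0\<close>.\<close>
      have "congr s (\<lambda>P t. cnj (V y x (P div n * s + t) (P mod n))) (\<lambda>t t'. 1\<^sub>m s $$ (t, t'))
          (j * n + v) (i * n + u) = C x y 0 (j * n + v) (i * n + u)" if "x < g" "j < d" "i < d" for x i j
      proof -
        have "congr s (\<lambda>P t. cnj (V y x (P div n * s + t) (P mod n))) (\<lambda>t t'. 1\<^sub>m s $$ (t, t'))
            (j * n + v) (i * n + u) = congr s (R x y) (\<lambda>t t'. \<Sum>b<l. B x y 0 b t t') (j * n + v) (i * n + u)"
          by (rule congr_cong) (use B_sum that y uv k in
              \<open>auto simp: V_block index_div index_mod s_def[symmetric]\<close>)
        also have "\<dots> = C x y 0 (j * n + v) (i * n + u)"
          unfolding congr_sum C_def
          by (rule sum.cong) (use FRB that y uv k in \<open>auto simp: s_def[symmetric] index_less_s\<close>)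
        finally show ?thesis .
      qed
      then have "compression (d * s) n (V y) {..<g} (1\<^sub>m d \<otimes>\<^sub>K 1\<^sub>m s) $$ (v, u) =
          (\<Sum>x<g. \<Sum>j<d. \<Sum>i<d. of_bool (j = i) * C x y 0 (j * n + v) (i * n + u))"
        using uv by (subst compression_kron_index) (auto simp: of_bool_def intro!: sum.cong)
      also have "\<dots> = of_bool (v = u)" using total uv by blast
      finally have "compression (d * s) n (V y) {..<g} (1\<^sub>m d \<otimes>\<^sub>K 1\<^sub>m s) $$ (v, u) =
          of_bool (v = u)" .
      then show "compression (d * s) n (V y) {..<g} (1\<^sub>m (d * s)) $$ (v, u) = 1\<^sub>m n $$ (v, u)"
        using uv by (simp add: kron_one)
    qed (auto simp: compression_def)
  next
    fix M assume M: "multimeter g k d M"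
    define N where "N y b = msum n (\<lambda>(x, a). \<Lambda> x y (M x a \<otimes>\<^sub>K BB a x y b)) ({..<g} \<times> {..<k})" for y b
    \<comment> \<open>\<open>N\<close> has the same effects as this \<open>N'\<close> in the
      relevant range, and so inherits the POVM property and the Choi matrix.\<close>
    obtain N' where N': "multimeter r l n N'" and
      eq: "\<Psi> (choi (d * g) k (multimeter_channel g k M)) = choi (n * r) l (multimeter_channel r l N')" and
      NF: "\<forall>y<r. \<forall>b<l. \<forall>u<n. \<forall>v<n. N' y b $$ (v, u) =
        (\<Sum>x<g. \<Sum>a<k. \<Sum>j<d. \<Sum>i<d. M x a $$ (j, i) * F x y a b (j * n + v) (i * n + u))"
      using image[OF M] by blast
    have NN': "N y b = N' y b" if "y < r" "b < l" for y b
    proof -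
      have N'car: "N' y b \<in> carrier_mat n n" using N' that by (simp add: multimeter_def povm_def psd_def)
      show ?thesis
      proof (rule eq_matI)
        fix v u assume "v < dim_row (N' y b)" "u < dim_col (N' y b)"
        then have uv: "v < n" "u < n" using N'car by auto
        then have "N y b $$ (v, u) = (\<Sum>x<g. \<Sum>a<k. \<Lambda> x y (M x a \<otimes>\<^sub>K BB a x y b) $$ (v, u))"
          by (simp add: N_def sum.cartesian_product case_prod_unfold)
        also have "\<dots> = N' y b $$ (v, u)"
          using NF uv that multi_car[OF M] by (auto simp: \<Lambda>_kron intro!: sum.cong)
        finally show "N y b $$ (v, u) = N' y b $$ (v, u)" .
      qed (use N'car in \<open>auto simp: N_def\<close>)
    qed
    have "multimeter r l n N"
      using N' NN' by (simp add: multimeter_def povm_def msum_def)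
    moreover have "\<Psi> (choi (d * g) k (multimeter_channel g k M)) =
        choi (n * r) l (multimeter_channel r l N)"
      unfolding eq by (rule choi_multimeter_channel_cong) (simp add: NN')
    ultimately show "let N = \<lambda>y b. msum n (\<lambda>(x, a). \<Lambda> x y (M x a \<otimes>\<^sub>K BB a x y b)) ({..<g} \<times> {..<k})
        in multimeter r l n N \<and> \<Psi> (choi (d * g) k (multimeter_channel g k M)) =
          choi (n * r) l (multimeter_channel r l N)"
      by (simp add: N_def[abs_def])
  qed
qed

end
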